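(* Let $y \in \mathbb{R}\setminus\{0\}$ and $a\in\mathbb{C}$ with $\operatorname{Re} a > 0$. Then Euler's constant $\gamma$ satisfies each of the following: $$\gamma = -\ln 4 - \frac{\pi}{a|y|}\ln\left(\frac{\Gamma\left(\frac{1}{2} + \frac{a|y|}{\pi}\right)}{\sqrt{\pi}}\right) + \int_0^\infty \tanh(at)\left(\frac{1}{t} - \frac{1}{|y|}\arctan\frac{|y|}{t}\right) dt,$$ $$\gamma= -\ln 4 - \frac{\pi}{a|y|}\ln\left(\frac{\Gamma\left(\frac{1}{2} + \frac{a|y|}{\pi}\right)}{\sqrt{\pi}}\right) + \frac{y^2}{a}\int_0^\infty \frac{\ln\cosh\left(a t\right)}{t^2\left(t^2 + y^2\right)}\, dt,$$ $$\gamma= 1 - \ln\left(\frac{4a|y|}{\pi}\right) + \int_0^\infty\left(\frac{\ln\cosh\left(a t\right)}{at^2} - \frac{t}{t^2 + y^2}\right)dt,$$ $$\gamma= 2-\ln\left(\frac{4a|y|}{\pi}\right) + \int_0^\infty \left(\frac{\ln\cosh\left(a t\right)}{at^2} - \frac{1}{|y|}\arctan\frac{|y|}{t}\right)dt,$$ $$\gamma= 1 - \ln\left(\frac{4a|y|}{\pi}\right) +\int_0^\infty \left(\frac{\tanh\left(a t\right)}{t} - \frac{1}{|y|}\arctan\frac{|y|}{t}\right)dt.$$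
   Context: $\gamma=\lim_{n\to\infty}\left(\sum_{k=1}^n \frac1k-\ln n\right)$ is Euler's constant. For complex $a$, each logarithm of an expression in $a$ denotes the branch that is analytic in $a$ on the half-plane $\operatorname{Re} a>0$ and real for real $a>0$ (in particular $\ln\Gamma$ is the analytic log-gamma function, and $\ln\cosh(at)$, $t>0$, is the analytic branch in $a$). *)

theory Defs
  imports "HOL-Complex_Analysis.Complex_Analysis"
begin

definition right_halfplane :: "complex set" where
  "right_halfplane = {z. Re z > 0}"

definition is_ln_branch :: "(complex \<Rightarrow> complex) \<Rightarrow> (complex \<Rightarrow> complex) \<Rightarrow> bool" where
  "is_ln_branch g f \<longleftrightarrow>
     g holomorphic_on right_halfplane \<and>
     (\<forall>z\<in>right_halfplane. exp (g z) = f z) \<and>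
     (\<forall>x::real. x > 0 \<longrightarrow> g (of_real x) \<in> \<real>)"

text \<open>
  \<open>halfplane_ln f a\<close> is the value at \<open>a\<close> of the logarithm of \<open>f\<close> that is analytic on the right
  half-plane and real on the positive real axis. It differs from \<open>Ln (f a)\<close> in general: for
  example, \<open>cosh\<close> takes negative real values in the half-plane. The description is unique for
  \<open>a\<close> in the half-plane because a branch is determined there (lemma \<open>is_ln_branch_unique\<close>),
  and a branch exists whenever \<open>f\<close> is holomorphic and nonzero on the half-plane and positive
  on the positive reals (lemma \<open>is_ln_branch_halfplane_ln\<close>).
\<close>
definition halfplane_ln :: "(complex \<Rightarrow> complex) \<Rightarrow> complex \<Rightarrow> complex" where
  "halfplane_ln f a = (THE w. \<exists>g. is_ln_branch g f \<and> w = g a)"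

lemma open_right_halfplane: "open right_halfplane"
  unfolding right_halfplane_def by (rule open_halfspace_Re_gt)

lemma convex_right_halfplane: "convex right_halfplane"
  unfolding right_halfplane_def by (rule convex_halfspace_Re_gt)

lemma is_ln_branch_unique:
  assumes g: "is_ln_branch g f" and h: "is_ln_branch h f" and a: "a \<in> right_halfplane"
  shows "g a = h a"
proof -
  let ?S = "right_halfplane"
  let ?U = "complex_of_real ` {0<..}"
  have eq: "g z - h z = 0" if "z \<in> ?U" for z
  proof -
    from that obtain x where x: "x > 0" "z = of_real x" by auto
    then have "z \<in> ?S" by (simp add: right_halfplane_def)
    with g h have e: "exp (g z) = exp (h z)" by (simp add: is_ln_branch_def)
    from g h x have "g z \<in> \<real>" "h z \<in> \<real>" by (auto simp: is_ln_branch_def)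
    then obtain u v :: real where uv: "g z = of_real u" "h z = of_real v"
      by (auto elim!: Reals_cases)
    with e have "complex_of_real (exp u) = complex_of_real (exp v)"
      by (simp add: exp_of_real)
    then have "u = v" unfolding of_real_eq_iff exp_inj_iff .
    with uv show ?thesis by simp
  qed
  have lim: "(1::complex) islimpt ?U"
  proof (rule islimptI)
    fix T :: "complex set" assume "1 \<in> T" "open T"
    then obtain e where e: "e > 0" "ball 1 e \<subseteq> T"
      by (meson open_contains_ball)
    then have "complex_of_real (1 + e/2) \<in> T"
      by (auto simp: subset_iff dist_norm)
    moreover have "complex_of_real (1 + e/2) \<in> ?U"
      using e by (intro imageI) auto
    moreover have "complex_of_real (1 + e/2) \<noteq> 1"
      using e by (simp add: complex_eq_iff)
    ultimately show "\<exists>y\<in>?U. y \<in> T \<and> y \<noteq> 1" by blast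
  qed
  have hol: "(\<lambda>z. g z - h z) holomorphic_on ?S"
    using g h by (auto simp: is_ln_branch_def intro!: holomorphic_intros)
  have "connected ?S" "?U \<subseteq> ?S" "1 \<in> ?S"
    by (auto simp: convex_connected convex_right_halfplane right_halfplane_def)
  from analytic_continuation[OF hol open_right_halfplane this lim eq a]
  have "g a - h a = 0" .
  then show ?thesis by simp
qed

lemma halfplane_ln_eq:
  assumes "is_ln_branch g f" and "a \<in> right_halfplane"
  shows "halfplane_ln f a = g a"
  unfolding halfplane_ln_def
  using assms is_ln_branch_unique by (intro the_equality) blast+

lemma is_ln_branch_halfplane_ln:
  assumes hol: "f holomorphic_on right_halfplane"
    and nz: "\<And>z. z \<in> right_halfplane \<Longrightarrow> f z \<noteq> 0"
    and pos: "\<And>x::real. x > 0 \<Longrightarrow> \<exists>r>0. f (of_real x) = of_real r"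
  shows "is_ln_branch (halfplane_ln f) f"
proof -
  let ?S = "right_halfplane"
  have inS: "complex_of_real x \<in> ?S" if "x > 0" for x
    using that by (simp add: right_halfplane_def)
  obtain g where g: "g holomorphic_on ?S" "\<And>z. z \<in> ?S \<Longrightarrow> f z = exp (g z)"
    using contractible_imp_holomorphic_log[OF hol convex_imp_contractible[OF convex_right_halfplane] nz]
    by blast
  have int: "\<exists>n::int. Im (g (of_real x)) = 2 * pi * n" if x: "x > 0" for x
  proof -
    from pos[OF x] obtain r where r: "r > 0" "f (of_real x) = of_real r" by blast
    with g(2)[OF inS[OF x]] have "exp (g (of_real x)) = exp (of_real (ln r))"
      by (simp add: exp_of_real)
    then show ?thesis by (auto simp: exp_eq)
  qed
  define p where "p = (\<lambda>x. Im (g (of_real x)))"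
  have "p constant_on {0<..}"
  proof (rule continuous_discrete_range_constant)
    show "connected {0::real<..}" by simp
    have "continuous_on {0<..} (\<lambda>x::real. g (of_real x))"
      by (rule continuous_on_compose2[OF holomorphic_on_imp_continuous_on[OF g(1)]])
         (auto intro!: continuous_intros inS)
    then show "continuous_on {0<..} p"
      unfolding p_def by (intro continuous_intros)
    show "\<exists>e>0. \<forall>y. y \<in> {0<..} \<and> p y \<noteq> p x \<longrightarrow> e \<le> norm (p y - p x)"
      if "x \<in> {0<..}" for x
    proof (intro exI[of _ "2 * pi"] conjI allI impI)
      fix y assume y: "y \<in> {0<..} \<and> p y \<noteq> p x"
      from int[of x] int[of y] that y obtain m n :: int
        where mn: "p x = 2 * pi * m" "p y = 2 * pi * n" unfolding p_def by auto
      with y have "n \<noteq> m" by auto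
      then have "1 \<le> \<bar>real_of_int (n - m)\<bar>" by linarith
      moreover have "norm (p y - p x) = 2 * pi * \<bar>real_of_int (n - m)\<bar>"
        by (simp add: mn abs_mult flip: right_diff_distrib)
      ultimately show "2 * pi \<le> norm (p y - p x)" by simp
    qed simp
  qed
  then obtain c where c: "\<And>x. x > 0 \<Longrightarrow> p x = c" by (auto simp: constant_on_def)
  from int[of 1] c[of 1] obtain k :: int where k: "c = 2 * pi * k" by (auto simp: p_def)
  define h where "h = (\<lambda>z. g z - of_int (2 * k) * (of_real pi * \<i>))"
  have h: "is_ln_branch h f"
    unfolding is_ln_branch_def
  proof (intro conjI ballI allI impI)
    show "h holomorphic_on ?S" unfolding h_def using g by (intro holomorphic_intros)
    show "exp (h z) = f z" if "z \<in> ?S" for z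
    proof -
      have "exp (h z) = exp (g z)" unfolding exp_eq h_def
        by (rule exI[of _ "- k"]) (simp add: algebra_simps)
      with g(2)[OF that] show ?thesis by simp
    qed
    show "h (of_real x) \<in> \<real>" if "x > 0" for x
      using c[OF that] k by (simp add: complex_is_Real_iff h_def p_def)
  qed
  have eq: "halfplane_ln f z = h z" if "z \<in> ?S" for z
    using halfplane_ln_eq[OF h that] .
  show ?thesis
    using h inS eq holomorphic_cong[OF refl eq] unfolding is_ln_branch_def by auto
qed

end

theory Submission
  imports Defs "HOL-Real_Asymp.Real_Asymp"
begin

text \<open>
  Write \<open>y > 0\<close> for the absolute value of the given parameter. Everything rests on one integral,
  \<open>K w = \<integral> tanh (a t) \<cdot> w\<^sup>2 / (t (t\<^sup>2 + w\<^sup>2)) dt\<close> over \<open>t > 0\<close>, evaluated for complex \<open>a\<close> directly, without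
  analytic continuation. The partial fractions of \<open>tanh\<close> (lemma \<open>tanh_partial_fractions\<close>), which are the
  logarithmic derivative of the reflection formula for \<open>Gamma\<close>, turn \<open>K w\<close> into a series of rational
  integrals, each elementary (lemma \<open>rational_product_integral\<close>), and the resulting series is that of
  a difference of digamma values: \<open>K w = Digamma (1/2 + a w / pi) - Digamma (1/2)\<close>
  (lemma \<open>tanh_kernel_integral\<close>). Here \<open>Digamma (1/2) = - \<gamma> - ln 4\<close>, which is where Euler's constant
  comes from.

  The integral \<open>K\<close> is used in two ways. First, \<open>arctan (y / t) / y\<close> is the mean over \<open>s\<close> in \<open>[0, 1]\<close>
  of \<open>t / (t\<^sup>2 + (s y)\<^sup>2)\<close>. So the integral of \<open>tanh (a t) (1 / t - arctan (y / t) / y)\<close> is by Fubini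
  the mean of \<open>K (s y)\<close> over \<open>s\<close>, and as \<open>Digamma\<close> is the derivative of \<open>ln_Gamma\<close>, this mean
  consists of the log-gamma term of the first formula and \<open>\<gamma> + ln 4\<close> (lemma \<open>tanh_arctan_integral\<close>).
  Integration by parts gives the second formula.

  Secondly, let \<open>I w\<close> be the integral of \<open>tanh (a t) / t - t / (t\<^sup>2 + w\<^sup>2)\<close>. On the one hand
  \<open>I w - ln w\<close> does not depend on \<open>w\<close>; on the other hand \<open>I w - K w\<close> tends to \<open>0\<close> as \<open>w\<close> grows, since
  \<open>1 - tanh (a t)\<close> decays, while \<open>K w\<close> is asymptotically \<open>Ln (a w / pi) + \<gamma> + ln 4\<close>. Hence
  \<open>I w = \<gamma> + Ln (4 a w / pi)\<close> (lemma \<open>tanh_minus_rational_integral\<close>). The last three formulas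
  differ from this one by integrals of total derivatives, namely those of \<open>t arctan (y / t) / y\<close> and of
  \<open>- ln cosh (a t) / (a t)\<close>.

  The branches of the logarithms are explicit: \<open>ln_Gamma\<close>, the principal \<open>Ln\<close>, and
  \<open>z + Ln (1 + exp (- 2 z)) - ln 2\<close> for \<open>ln cosh\<close>.
\<close>

section \<open>Integrals over the positive half-line\<close>

text \<open>
  Existence and value of the integral in one statement: sums, differences and series of such
  integrals then need no separate integrability arguments.
\<close>
definition half_line_integral :: "(real \<Rightarrow> complex) \<Rightarrow> complex \<Rightarrow> bool" where
  "half_line_integral f I \<longleftrightarrow>
     has_bochner_integral lborel (\<lambda>t. indicator {0<..} t *\<^sub>R f t) I"

lemma half_line_integral_iff:
  "half_line_integral f I \<longleftrightarrow>
     set_integrable lborel {0<..} f \<and> (LINT t:{0<..}|lborel. f t) = I"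
  by (simp add: half_line_integral_def has_bochner_integral_iff set_integrable_def
        set_lebesgue_integral_def)

lemma half_line_integral_add:
  "half_line_integral f I \<Longrightarrow> half_line_integral g J \<Longrightarrow>
     half_line_integral (\<lambda>t. f t + g t) (I + J)"
  unfolding half_line_integral_def
  by (drule (1) has_bochner_integral_add) (simp add: scaleR_add_right)

lemma half_line_integral_diff:
  "half_line_integral f I \<Longrightarrow> half_line_integral g J \<Longrightarrow>
     half_line_integral (\<lambda>t. f t - g t) (I - J)"
  unfolding half_line_integral_def
  by (drule (1) has_bochner_integral_diff) (simp add: scaleR_diff_right)

lemma half_line_integral_cmult:
  "half_line_integral f I \<Longrightarrow> half_line_integral (\<lambda>t. c * f t) (c * I)"
  unfolding half_line_integral_def
  by (drule has_bochner_integral_bounded_linear[OF bounded_linear_mult_right[of c]]) simp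

lemma half_line_integral_cong:
  assumes "half_line_integral f I" "\<And>t. t > 0 \<Longrightarrow> f t = g t" "I = J"
  shows "half_line_integral g J"
proof -
  have "(\<lambda>t. indicator {0<..} t *\<^sub>R f t) = (\<lambda>t. indicator {0<..} t *\<^sub>R g t)"
    by (auto simp: fun_eq_iff indicator_def assms(2))
  with assms show ?thesis unfolding half_line_integral_def by simp
qed

lemma half_line_integral_of_real:
  fixes f :: "real \<Rightarrow> real"
  assumes "set_integrable lborel {0<..} f" "(LINT t:{0<..}|lborel. f t) = I"
  shows "half_line_integral (\<lambda>t. complex_of_real (f t)) (complex_of_real I)"
proof -
  have "has_bochner_integral lborel (\<lambda>t. indicator {0<..} t *\<^sub>R f t) I"
    using assms by (simp add: has_bochner_integral_iff set_integrable_def set_lebesgue_integral_def)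
  from has_bochner_integral_of_real[OF this, where 'a=complex]
  show ?thesis unfolding half_line_integral_def
    by (rule has_bochner_integral_cong[THEN iffD1, rotated 3]) (auto simp: indicator_def)
qed

text \<open>
  Integrability is a hypothesis here, as it does not follow from the limits of a complex
  antiderivative; for nonnegative integrands it does, as the next lemma says.
\<close>
lemma half_line_integral_FTC:
  fixes F f :: "real \<Rightarrow> complex"
  assumes "\<And>t. t > 0 \<Longrightarrow> (F has_vector_derivative f t) (at t)"
    and "continuous_on {0<..} f" and "set_integrable lborel {0<..} f"
    and "(F \<longlongrightarrow> A) (at_right 0)" and "(F \<longlongrightarrow> B) at_top"
  shows "half_line_integral f (B - A)"
proof -
  have "(LBINT t=0..\<infinity>. f t) = B - A"
  proof (rule interval_integral_FTC_integrable)
    show "isCont f x" if "0 < ereal x" for x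
      using assms(2) that by (simp add: continuous_on_eq_continuous_at)
    show "((F \<circ> real_of_ereal) \<longlongrightarrow> A) (at_right 0)"
      using assms(4) unfolding zero_ereal_def by (simp only: ereal_tendsto_simps)
    show "((F \<circ> real_of_ereal) \<longlongrightarrow> B) (at_left \<infinity>)"
      using assms(5) by (simp add: ereal_tendsto_simps)
  qed (use assms in \<open>auto simp: zero_ereal_def\<close>)
  thus ?thesis using assms(3)
    by (simp add: half_line_integral_iff interval_lebesgue_integral_0_infty)
qed

lemma half_line_integral_FTC_nonneg:
  fixes F f :: "real \<Rightarrow> real"
  assumes "\<And>t. t > 0 \<Longrightarrow> (F has_real_derivative f t) (at t)"
    and "continuous_on {0<..} f" and "\<And>t. t > 0 \<Longrightarrow> f t \<ge> 0"
    and "(F \<longlongrightarrow> A) (at_right 0)" and "(F \<longlongrightarrow> B) at_top"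
  shows "set_integrable lborel {0<..} f" "(LINT t:{0<..}|lborel. f t) = B - A"
proof -
  have *: "isCont f x" if "0 < ereal x" for x
    using assms(2) that by (simp add: continuous_on_eq_continuous_at)
  have A: "((F \<circ> real_of_ereal) \<longlongrightarrow> A) (at_right 0)"
    using assms(4) unfolding zero_ereal_def by (simp only: ereal_tendsto_simps)
  have B: "((F \<circ> real_of_ereal) \<longlongrightarrow> B) (at_left \<infinity>)"
    using assms(5) by (simp add: ereal_tendsto_simps)
  have "set_integrable lborel (einterval 0 \<infinity>) f" "(LBINT t=0..\<infinity>. f t) = B - A"
    by (rule interval_integral_FTC_nonneg[OF _ _ * _ A B]; use assms in \<open>auto simp: zero_ereal_def\<close>)+
  thus "set_integrable lborel {0<..} f" "(LINT t:{0<..}|lborel. f t) = B - A"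
    by (simp_all add: interval_lebesgue_integral_0_infty set_integrable_def einterval_def greaterThan_def)
qed

lemma half_line_integrable_bound:
  fixes f :: "real \<Rightarrow> complex"
  assumes "continuous_on {0<..} f" "set_integrable lborel {0<..} g"
    "\<And>t. t > 0 \<Longrightarrow> norm (f t) \<le> g t"
  shows "set_integrable lborel {0<..} f"
proof (rule set_integrable_bound[OF assms(2)])
  have "f \<in> borel_measurable (restrict_space borel {0<..})"
    by (rule borel_measurable_continuous_on_restrict[OF assms(1)])
  thus "set_borel_measurable lborel {0<..} f"
    by (simp add: set_borel_measurable_def borel_measurable_restrict_space_iff)
  show "AE x in lborel. x \<in> {0<..} \<longrightarrow> norm (f x) \<le> norm (g x)"
    using assms(3) by (intro AE_I2 impI) (fastforce intro: order_trans)
qed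

lemma half_line_integral_norm_le:
  assumes "half_line_integral f I" "set_integrable lborel {0<..} g"
    "\<And>t. t > 0 \<Longrightarrow> norm (f t) \<le> g t"
  shows "norm I \<le> (LINT t:{0<..}|lborel. g t)"
proof -
  have "norm (LINT t|lborel. indicator {0<..} t *\<^sub>R f t) \<le> (LINT t|lborel. indicator {0<..} t *\<^sub>R g t)"
  proof (rule Bochner_Integration.integral_norm_bound_integral)
    show "integrable lborel (\<lambda>t. indicator {0<..} t *\<^sub>R f t)"
      using assms(1) by (simp add: half_line_integral_def has_bochner_integral_iff)
    show "integrable lborel (\<lambda>t. indicator {0<..} t *\<^sub>R g t)"
      using assms(2) by (simp add: set_integrable_def)
  qed (use assms(3) in \<open>auto simp: indicator_def\<close>)
  thus ?thesis using assms(1)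
    by (simp add: half_line_integral_def has_bochner_integral_iff set_lebesgue_integral_def)
qed

lemma half_line_integral_unique:
  "half_line_integral f I \<Longrightarrow> half_line_integral f J \<Longrightarrow> I = J"
  by (auto simp: half_line_integral_iff)

text \<open>
  Term-by-term integration: domination by \<open>D n * g t\<close> with \<open>D\<close> summable and \<open>g\<close> integrable makes
  the sum of the integrals of the norms finite.
\<close>
lemma half_line_integral_sums:
  assumes f: "\<And>n. half_line_integral (f n) (I n)"
    and bound: "\<And>n t. t > 0 \<Longrightarrow> norm (f n t) \<le> D n * g t"
    and D: "summable D" "\<And>n. D n \<ge> 0"
    and g: "set_integrable lborel {0<..} g"
    and sums: "\<And>t. t > 0 \<Longrightarrow> (\<lambda>n. f n t) sums F t" "I sums J"
  shows "half_line_integral F J"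
proof -
  let ?f = "\<lambda>n t. indicator {0<..} t *\<^sub>R f n t" and ?g = "\<lambda>t. indicator {0<..} t *\<^sub>R g t"
  have int: "integrable lborel (?f n)" and val: "integral\<^sup>L lborel (?f n) = I n" for n
    using f[of n] by (simp_all add: half_line_integral_def has_bochner_integral_iff)
  have gi: "integrable lborel ?g" using g by (simp add: set_integrable_def)
  have bnd: "norm (?f n t) \<le> D n * ?g t" for n t
    using bound[of t n] by (auto simp: indicator_def)
  have s1: "summable (\<lambda>n. norm (?f n t))" for t
  proof (rule summable_comparison_test')
    show "summable (\<lambda>n. D n * ?g t)" using D by (intro summable_mult2)
    show "\<And>n. n \<ge> 0 \<Longrightarrow> norm (norm (?f n t)) \<le> D n * ?g t" using bnd by simp
  qed
  have s2: "summable (\<lambda>n. \<integral>t. norm (?f n t) \<partial>lborel)"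
  proof (rule summable_comparison_test')
    show "summable (\<lambda>n. D n * integral\<^sup>L lborel ?g)" using D by (intro summable_mult2)
    fix n
    have "(\<integral>t. norm (?f n t) \<partial>lborel) \<le> (\<integral>t. D n * ?g t \<partial>lborel)"
      by (intro integral_mono integrable_norm int integrable_mult_right gi bnd)
    thus "norm (\<integral>t. norm (?f n t) \<partial>lborel) \<le> D n * integral\<^sup>L lborel ?g"
      by simp
  qed
  have eq: "(\<lambda>t. \<Sum>n. ?f n t) = (\<lambda>t. indicator {0<..} t *\<^sub>R F t)"
    using sums(1) by (auto simp: fun_eq_iff indicator_def sums_iff)
  have "integrable lborel (\<lambda>t. \<Sum>n. ?f n t)"
    by (rule integrable_suminf[OF int AE_I2[OF s1] s2])
  moreover have "(\<integral>t. (\<Sum>n. ?f n t) \<partial>lborel) = J"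
    using sums_integral[OF int AE_I2[OF s1] s2] sums(2) unfolding val by (simp add: sums_iff)
  ultimately show ?thesis unfolding eq half_line_integral_def has_bochner_integral_iff by simp
qed

section \<open>A rational integral with a complex parameter\<close>

lemma inverse_sum_squares_integral:
  assumes "w > 0"
  shows "set_integrable lborel {0<..} (\<lambda>t::real. 1 / (t\<^sup>2 + w\<^sup>2))"
    and "(LINT t:{0<..}|lborel. 1 / (t\<^sup>2 + w\<^sup>2)) = pi / 2 / w"
proof -
  have nz: "t\<^sup>2 + w\<^sup>2 > 0" for t using assms by (simp add: add_nonneg_pos)
  have nz': "t\<^sup>2 + w\<^sup>2 \<noteq> 0" for t using nz[of t] by linarith
  have d: "((\<lambda>t. arctan (t / w) / w) has_real_derivative 1 / (t\<^sup>2 + w\<^sup>2)) (at t)" for t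
  proof -
    have "1 + (t / w)\<^sup>2 = (t\<^sup>2 + w\<^sup>2) / w\<^sup>2"
      using assms by (simp add: field_simps)
    thus ?thesis
      using assms nz[of t] by (auto intro!: derivative_eq_intros simp: power2_eq_square)
  qed
  have c: "continuous_on {0<..} (\<lambda>t::real. 1 / (t\<^sup>2 + w\<^sup>2))"
    using nz' by (intro continuous_intros) auto
  have A: "((\<lambda>t. arctan (t / w) / w) \<longlongrightarrow> 0) (at_right 0)"
    using assms by (auto intro!: tendsto_eq_intros)
  have B: "((\<lambda>t. arctan (t / w) / w) \<longlongrightarrow> pi / 2 / w) at_top"
  proof (intro tendsto_intros filterlim_compose[OF tendsto_arctan_at_top])
    show "filterlim (\<lambda>t. t / w) at_top at_top"
      using assms by real_asymp
  qed (use assms in auto)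
  note * = half_line_integral_FTC_nonneg[OF d c _ A B]
  show "set_integrable lborel {0<..} (\<lambda>t::real. 1 / (t\<^sup>2 + w\<^sup>2))"
    by (rule *) (use nz in \<open>auto intro: less_imp_le\<close>)
  show "(LINT t:{0<..}|lborel. 1 / (t\<^sup>2 + w\<^sup>2)) = pi / 2 / w"
    by (subst *) (use nz in \<open>auto intro: less_imp_le\<close>)
qed

lemma norm_of_real_sum_squares:
  "norm ((of_real t)\<^sup>2 + (of_real w)\<^sup>2 :: complex) = t\<^sup>2 + w\<^sup>2"
proof -
  have "(of_real t)\<^sup>2 + (of_real w)\<^sup>2 = (of_real (t\<^sup>2 + w\<^sup>2) :: complex)" by simp
  thus ?thesis by (simp only: norm_of_real) simp
qed

text \<open>
  Both factors of \<open>t\<^sup>2 + c\<^sup>2 = (c + \<i> t) (c - \<i> t)\<close> have real part \<open>Re c\<close>. The bound does not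
  depend on \<open>t\<close>, and its reciprocal is summable over \<open>c = (n + 1/2) pi / a\<close>, the values that come from
  the poles of \<open>tanh (a t)\<close>.
\<close>
lemma norm_square_add_ge:
  assumes "Re c > 0"
  shows "(Re c)\<^sup>2 \<le> norm ((of_real t)\<^sup>2 + c\<^sup>2)"
proof -
  have "(of_real t)\<^sup>2 + c\<^sup>2 = (c + \<i> * of_real t) * (c - \<i> * of_real t)"
    by (simp add: algebra_simps power2_eq_square)
  hence "norm ((of_real t)\<^sup>2 + c\<^sup>2) = norm (c + \<i> * of_real t) * norm (c - \<i> * of_real t)"
    by (simp add: norm_mult)
  also have "\<dots> \<ge> Re c * Re c"
    using complex_Re_le_cmod[of "c + \<i> * of_real t"] complex_Re_le_cmod[of "c - \<i> * of_real t"] assms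
    by (intro mult_mono) auto
  finally show ?thesis by (simp add: power2_eq_square)
qed

lemma square_add_nonzero:
  assumes "Re c > 0"
  shows "(of_real t)\<^sup>2 + c\<^sup>2 \<noteq> 0"
  using norm_square_add_ge[OF assms, of t] assms by auto

text \<open>
  This is \<open>arctan (t / c) / c\<close>. Since \<open>c + \<i> t\<close> and \<open>c - \<i> t\<close> stay in the right half-plane for
  real \<open>t\<close>, this form avoids every branch cut and has visible limits at \<open>0\<close> and at infinity.
\<close>
definition arctan_quotient :: "complex \<Rightarrow> real \<Rightarrow> complex" where
  "arctan_quotient c t = (Ln (c + \<i> * of_real t) - Ln (c - \<i> * of_real t)) / (2 * \<i> * c)"

lemma arctan_quotient_derivative:
  assumes "Re c > 0"
  shows "(arctan_quotient c has_vector_derivative 1 / ((of_real t)\<^sup>2 + c\<^sup>2)) (at t within S)"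
proof -
  have c: "c \<noteq> 0" using assms by auto
  have *: "c + \<i> * of_real t \<notin> \<real>\<^sub>\<le>\<^sub>0" "c - \<i> * of_real t \<notin> \<real>\<^sub>\<le>\<^sub>0"
    using assms by (auto simp: complex_nonpos_Reals_iff)
  hence nz: "c + \<i> * of_real t \<noteq> 0" "c - \<i> * of_real t \<noteq> 0" by auto
  have "\<i> / (c + \<i> * of_real t) + \<i> / (c - \<i> * of_real t) = 2 * \<i> * c / ((of_real t)\<^sup>2 + c\<^sup>2)"
  proof -
    have "(of_real t)\<^sup>2 + c\<^sup>2 = (c + \<i> * of_real t) * (c - \<i> * of_real t)"
      by (simp add: algebra_simps power2_eq_square)
    thus ?thesis using nz by (simp add: divide_simps) (simp add: algebra_simps)
  qed
  hence eq: "(\<i> / (c + \<i> * of_real t) + \<i> / (c - \<i> * of_real t)) / (2 * \<i> * c) = 1 / ((of_real t)\<^sup>2 + c\<^sup>2)"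
    using c by simp
  have "((\<lambda>z. (Ln (c + \<i> * z) - Ln (c - \<i> * z)) / (2 * \<i> * c)) has_field_derivative
      (\<i> / (c + \<i> * of_real t) + \<i> / (c - \<i> * of_real t)) / (2 * \<i> * c)) (at (of_real t))"
    using * c by (auto intro!: derivative_eq_intros simp: field_simps)
  hence "((\<lambda>z. (Ln (c + \<i> * z) - Ln (c - \<i> * z)) / (2 * \<i> * c)) has_field_derivative
      1 / ((of_real t)\<^sup>2 + c\<^sup>2)) (at (of_real t))"
    by (simp only: eq)
  from has_vector_derivative_real_field[OF this]
  show ?thesis unfolding arctan_quotient_def[abs_def] .
qed

text \<open>
  After division by \<open>t > 0\<close>, which cancels in the difference of the logarithms, their arguments
  tend to \<open>\<i>\<close> and \<open>- \<i>\<close>.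
\<close>
lemma arctan_quotient_at_top:
  assumes "Re c > 0"
  shows "(arctan_quotient c \<longlongrightarrow> of_real pi / (2 * c)) at_top"
proof -
  have c: "c \<noteq> 0" using assms by auto
  have eq: "Ln (c + \<i> * of_real t) - Ln (c - \<i> * of_real t) =
            Ln (\<i> + c / of_real t) - Ln (- \<i> + c / of_real t)" if t: "t > 0" for t
  proof -
    have "c + \<i> * of_real t = of_real t * (\<i> + c / of_real t)"
         "c - \<i> * of_real t = of_real t * (- \<i> + c / of_real t)"
      using t by (auto simp: field_simps)
    moreover have "\<i> + c / of_real t \<noteq> 0" "- \<i> + c / of_real t \<noteq> 0"
      using assms t by (auto simp: complex_eq_iff)
    ultimately show ?thesis using t by (simp add: Ln_times_of_real)
  qed
  have lim: "((\<lambda>t. c / of_real t) \<longlongrightarrow> 0) at_top"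
    by (intro tendsto_divide_0[OF tendsto_const] filterlim_of_real_at_infinity)
  have "((\<lambda>t. (Ln (\<i> + c / of_real t) - Ln (- \<i> + c / of_real t)) / (2 * \<i> * c)) \<longlongrightarrow>
         (Ln (\<i> + 0) - Ln (- \<i> + 0)) / (2 * \<i> * c)) at_top"
    using c by (intro tendsto_intros lim) (auto simp: complex_nonpos_Reals_iff)
  hence "((\<lambda>t. (Ln (\<i> + c / of_real t) - Ln (- \<i> + c / of_real t)) / (2 * \<i> * c)) \<longlongrightarrow>
         of_real pi / (2 * c)) at_top"
    using c by (simp add: field_simps)
  thus ?thesis
  proof (rule Lim_transform_eventually)
    show "\<forall>\<^sub>F t in at_top. (Ln (\<i> + c / of_real t) - Ln (- \<i> + c / of_real t)) / (2 * \<i> * c)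
            = arctan_quotient c t"
      using eventually_gt_at_top[of 0] by eventually_elim (simp add: arctan_quotient_def eq)
  qed
qed

lemma arctan_quotient_at_0:
  assumes "Re c > 0"
  shows "(arctan_quotient c \<longlongrightarrow> 0) (at_right 0)"
proof -
  have "isCont (arctan_quotient c) 0"
    using has_vector_derivative_continuous[OF arctan_quotient_derivative[OF assms]] by simp
  hence "(arctan_quotient c \<longlongrightarrow> arctan_quotient c 0) (at 0)" by (simp add: isCont_def)
  thus ?thesis by (simp add: arctan_quotient_def filterlim_at_split)
qed

lemma rational_product_integrable:
  assumes c: "Re c > 0" and w: "w > 0"
  shows "set_integrable lborel {0<..}
     (\<lambda>t. 1 / (((of_real t)\<^sup>2 + c\<^sup>2) * ((of_real t)\<^sup>2 + (of_real w)\<^sup>2)))"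
    and "norm (1 / (((of_real t)\<^sup>2 + c\<^sup>2) * ((of_real t)\<^sup>2 + (of_real w)\<^sup>2)))
       \<le> 1 / (Re c)\<^sup>2 * (1 / (t\<^sup>2 + w\<^sup>2))"
proof -
  have w': "norm ((of_real t)\<^sup>2 + (of_real w :: complex)\<^sup>2) = t\<^sup>2 + w\<^sup>2" for t :: real
    by (rule norm_of_real_sum_squares)
  have wnz: "(of_real t)\<^sup>2 + (of_real w :: complex)\<^sup>2 \<noteq> 0" for t :: real
    using square_add_nonzero[of "of_real w" t] w by simp
  have pos: "t\<^sup>2 + w\<^sup>2 > 0" for t using w by (simp add: add_nonneg_pos)
  show bnd: "norm (1 / (((of_real t)\<^sup>2 + c\<^sup>2) * ((of_real t)\<^sup>2 + (of_real w)\<^sup>2)))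
       \<le> 1 / (Re c)\<^sup>2 * (1 / (t\<^sup>2 + w\<^sup>2))" for t :: real
    unfolding norm_divide norm_mult w'
    using norm_square_add_ge[OF c, of t] c pos[of t]
    by (simp add: divide_simps zero_less_mult_iff mult_le_cancel_right)
  show "set_integrable lborel {0<..}
     (\<lambda>t. 1 / (((of_real t)\<^sup>2 + c\<^sup>2) * ((of_real t)\<^sup>2 + (of_real w)\<^sup>2)))"
    by (rule half_line_integrable_bound[OF _ set_integrable_mult_right[OF inverse_sum_squares_integral(1)[OF w]] bnd])
       (use square_add_nonzero[OF c] wnz in \<open>auto intro!: continuous_intros\<close>)
qed

text \<open>
  Partial fractions in \<open>t\<^sup>2\<close>, with factor \<open>1 / (c\<^sup>2 - w\<^sup>2)\<close>. The confluent case \<open>c = w\<close> has the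
  antiderivative \<open>(t / (t\<^sup>2 + w\<^sup>2) + arctan (t / w) / w) / (2 w\<^sup>2)\<close>.
\<close>
lemma rational_product_integral:
  assumes c: "Re c > 0" and w: "w > 0"
  shows "half_line_integral
    (\<lambda>t. 1 / (((of_real t)\<^sup>2 + c\<^sup>2) * ((of_real t)\<^sup>2 + (of_real w)\<^sup>2)))
    (of_real pi / (2 * c * of_real w * (c + of_real w)))"
proof -
  define v where "v = complex_of_real w"
  have v: "Re v > 0" using w by (simp add: v_def)
  have nz: "c \<noteq> 0" "v \<noteq> 0" "c + v \<noteq> 0" using c v by (auto simp: complex_eq_iff)
  note nz2 = square_add_nonzero[OF c] square_add_nonzero[OF v]
  have cont: "continuous_on {0<..} (\<lambda>t::real. 1 / (((of_real t)\<^sup>2 + c\<^sup>2) * ((of_real t)\<^sup>2 + v\<^sup>2)))"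
    using nz2 by (auto intro!: continuous_intros)
  note int = rational_product_integrable(1)[OF c w, folded v_def]
  have "half_line_integral (\<lambda>t. 1 / (((of_real t)\<^sup>2 + c\<^sup>2) * ((of_real t)\<^sup>2 + v\<^sup>2)))
    (of_real pi / (2 * c * v * (c + v)))"
  proof (cases "c = v")
    case False
    have "c - v \<noteq> 0" using False by auto
    hence ne: "(c + v) * (c - v) \<noteq> 0" using nz by simp
    have sq: "(c + v) * (c - v) = c\<^sup>2 - v\<^sup>2" by (simp add: algebra_simps power2_eq_square)
    have A: "((\<lambda>t. (arctan_quotient v t - arctan_quotient c t) / ((c + v) * (c - v))) \<longlongrightarrow>
           (0 - 0) / ((c + v) * (c - v))) (at_right 0)"
      using ne by (intro tendsto_intros arctan_quotient_at_0 c v)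
    have B: "((\<lambda>t. (arctan_quotient v t - arctan_quotient c t) / ((c + v) * (c - v))) \<longlongrightarrow>
           (of_real pi / (2 * v) - of_real pi / (2 * c)) / ((c + v) * (c - v))) at_top"
      using ne by (intro tendsto_intros arctan_quotient_at_top c v)
    have D: "((\<lambda>t. (arctan_quotient v t - arctan_quotient c t) / ((c + v) * (c - v))) has_vector_derivative
            1 / (((of_real t)\<^sup>2 + c\<^sup>2) * ((of_real t)\<^sup>2 + v\<^sup>2))) (at t)" for t
    proof -
      have "((\<lambda>t. (arctan_quotient v t - arctan_quotient c t) / ((c + v) * (c - v))) has_vector_derivative
            (1 / ((of_real t)\<^sup>2 + v\<^sup>2) - 1 / ((of_real t)\<^sup>2 + c\<^sup>2)) / ((c + v) * (c - v))) (at t)"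
        by (intro has_vector_derivative_divide has_vector_derivative_diff arctan_quotient_derivative c v)
      moreover have "1 / ((of_real t)\<^sup>2 + v\<^sup>2) - 1 / ((of_real t)\<^sup>2 + c\<^sup>2) =
          (c\<^sup>2 - v\<^sup>2) / (((of_real t)\<^sup>2 + c\<^sup>2) * ((of_real t)\<^sup>2 + v\<^sup>2))"
        using nz2[of t] by (simp add: divide_simps)
      ultimately show ?thesis using ne unfolding sq by simp
    qed
    have "half_line_integral (\<lambda>t. 1 / (((of_real t)\<^sup>2 + c\<^sup>2) * ((of_real t)\<^sup>2 + v\<^sup>2)))
      ((of_real pi / (2 * v) - of_real pi / (2 * c)) / ((c + v) * (c - v)) - (0 - 0) / ((c + v) * (c - v)))"
      by (rule half_line_integral_FTC[OF D cont int A B])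
    thus ?thesis
    proof (rule half_line_integral_cong)
      have "of_real pi / (2 * v) - of_real pi / (2 * c) = of_real pi * (c - v) / (2 * c * v)"
        using nz by (simp add: field_simps)
      thus "(of_real pi / (2 * v) - of_real pi / (2 * c)) / ((c + v) * (c - v)) - (0 - 0) / ((c + v) * (c - v))
          = of_real pi / (2 * c * v * (c + v))"
        using ne by (simp add: mult_ac)
    qed auto
  next
    case True
    define F where "F = (\<lambda>t. (of_real t / ((of_real t)\<^sup>2 + v\<^sup>2) + arctan_quotient v t) / (2 * v\<^sup>2))"
    have A: "(F \<longlongrightarrow> (0 / (0\<^sup>2 + v\<^sup>2) + 0) / (2 * v\<^sup>2)) (at_right 0)"
      unfolding F_def using nz
      by (intro tendsto_intros arctan_quotient_at_0 v) (auto intro!: tendsto_eq_intros)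
    have l: "((\<lambda>t. complex_of_real (t / (t\<^sup>2 + w\<^sup>2))) \<longlongrightarrow> of_real 0) at_top"
      by (intro tendsto_of_real) real_asymp
    have B: "(F \<longlongrightarrow> (0 + of_real pi / (2 * v)) / (2 * v\<^sup>2)) at_top"
      unfolding F_def using nz l
      by (intro tendsto_intros arctan_quotient_at_top v) (auto simp: v_def)
    have D: "(F has_vector_derivative 1 / (((of_real t)\<^sup>2 + c\<^sup>2) * ((of_real t)\<^sup>2 + v\<^sup>2))) (at t)" for t
    proof -
      let ?q = "(of_real t)\<^sup>2 + v\<^sup>2"
      have "((\<lambda>z. z / (z\<^sup>2 + v\<^sup>2)) has_field_derivative (?q - 2 * (of_real t)\<^sup>2) / ?q\<^sup>2) (at (of_real t))"
        using nz2(2)[of t] by (auto intro!: derivative_eq_intros simp: power2_eq_square)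
      from has_vector_derivative_real_field[OF this]
      have "(F has_vector_derivative ((?q - 2 * (of_real t)\<^sup>2) / ?q\<^sup>2 + 1 / ?q) / (2 * v\<^sup>2)) (at t)"
        unfolding F_def
        by (intro has_vector_derivative_divide has_vector_derivative_add arctan_quotient_derivative v)
      also have "((?q - 2 * (of_real t)\<^sup>2) / ?q\<^sup>2 + 1 / ?q) = (2 * v\<^sup>2) / (?q * ?q)"
        using nz2(2)[of t] by (simp add: divide_simps power2_eq_square)
      finally show ?thesis using nz True by simp
    qed
    have "half_line_integral (\<lambda>t. 1 / (((of_real t)\<^sup>2 + c\<^sup>2) * ((of_real t)\<^sup>2 + v\<^sup>2)))
      ((0 + of_real pi / (2 * v)) / (2 * v\<^sup>2) - (0 / (0\<^sup>2 + v\<^sup>2) + 0) / (2 * v\<^sup>2))"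
      by (rule half_line_integral_FTC[OF D cont int A B])
    thus ?thesis
      by (rule half_line_integral_cong) (use True nz in \<open>auto simp: field_simps power2_eq_square\<close>)
  qed
  thus ?thesis by (simp add: v_def)
qed

section \<open>Partial fractions of the hyperbolic tangent\<close>

text \<open>
  The logarithmic derivative of \<open>Gamma (1/2 + z) * Gamma (1/2 - z) = pi / cos (pi z)\<close>. Off the
  real axis none of the functions involved has a pole or a zero.
\<close>
lemma Digamma_half_reflection:
  assumes "Im z \<noteq> 0"
  shows "Digamma (1/2 + z) - Digamma (1/2 - z) = of_real pi * tan (of_real pi * z :: complex)"
proof -
  have ni: "1/2 + z \<notin> \<int>\<^sub>\<le>\<^sub>0 \<and> 1/2 - z \<notin> \<int>\<^sub>\<le>\<^sub>0 \<and> 1/2 + z \<notin> \<int>" if "Im z \<noteq> 0" for z :: complex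
    using that by (auto elim!: nonpos_Ints_cases Ints_cases simp: complex_eq_iff)
  have prod: "Gamma (1/2 + z) * Gamma (1/2 - z) * cos (of_real pi * z) = of_real pi"
    if z: "Im z \<noteq> 0" for z
  proof -
    have "sin (of_real pi * (1/2 + z)) = cos (of_real pi * z)"
      by (simp add: ring_distribs sin_add)
    moreover have "1 - (1/2 + z) = 1/2 - z" by simp
    moreover have "sin (of_real pi * (1/2 + z)) \<noteq> 0"
      using ni[OF z] by (simp add: sin_eq_0) (metis Ints_of_int)
    ultimately show ?thesis
      using Gamma_reflection_complex[of "1/2 + z"] by (simp add: field_simps)
  qed
  let ?f = "\<lambda>z::complex. Gamma (1/2 + z) * Gamma (1/2 - z) * cos (of_real pi * z)"
  have "(?f has_field_derivative
      (Gamma (1/2 + z) * Gamma (1/2 - z)) *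
        ((Digamma (1/2 + z) - Digamma (1/2 - z)) * cos (of_real pi * z) - of_real pi * sin (of_real pi * z))) (at z)"
    using ni[OF assms] by (auto intro!: derivative_eq_intros simp: algebra_simps)
  moreover have "(?f has_field_derivative 0) (at z)"
  proof (rule has_field_derivative_transform_within_open[where f = "\<lambda>_. of_real pi"])
    show "open {z. Im z \<noteq> 0}" 
      by (intro open_Collect_neq continuous_intros)
  qed (use assms prod in auto)
  ultimately have "(Gamma (1/2 + z) * Gamma (1/2 - z)) *
        ((Digamma (1/2 + z) - Digamma (1/2 - z)) * cos (of_real pi * z) - of_real pi * sin (of_real pi * z)) = 0"
    by (rule DERIV_unique)
  moreover have "Gamma (1/2 + z) \<noteq> 0" "Gamma (1/2 - z) \<noteq> 0" "cos (of_real pi * z) \<noteq> 0"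
    using prod[OF assms] by auto
  ultimately have "(Digamma (1/2 + z) - Digamma (1/2 - z)) * cos (of_real pi * z) = of_real pi * sin (of_real pi * z)"
    by simp
  thus ?thesis using \<open>cos (of_real pi * z) \<noteq> 0\<close> by (simp add: tan_def eq_divide_eq)
qed

lemma Digamma_diff_sums:
  assumes "z \<noteq> 0" "w \<noteq> 0"
  shows "(\<lambda>n. 1 / (of_nat n + z) - 1 / (of_nat n + w :: complex)) sums (Digamma w - Digamma z)"
proof -
  have *: "(\<lambda>n. inverse (of_nat (Suc n)) - inverse (z + of_nat n)) sums (Digamma z + euler_mascheroni)"
    if "z \<noteq> 0" for z :: complex
    using summable_sums[OF summable_Digamma[OF that]] by (simp add: Digamma_def)
  from sums_diff[OF *[OF assms(2)] *[OF assms(1)]] show ?thesis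
    by (simp add: field_simps)
qed

text \<open>
  The reflection formula for \<open>Digamma\<close> at \<open>\<i> z / pi\<close>, with both digamma values written as series.
\<close>
lemma tanh_partial_fractions:
  assumes "Re z \<noteq> 0"
  shows "(\<lambda>n. 2 * z / (z\<^sup>2 + (of_real ((real n + 1/2) * pi))\<^sup>2)) sums tanh z"
proof -
  define u where "u = \<i> * z / of_real pi"
  have im: "Im u \<noteq> 0" using assms by (simp add: u_def)
  hence nz: "of_nat n + (1/2 - u) \<noteq> 0" "of_nat n + (1/2 + u) \<noteq> 0" for n
    by (auto simp: complex_eq_iff)
  have "(\<lambda>n. 1 / (of_nat n + (1/2 - u)) - 1 / (of_nat n + (1/2 + u)))
          sums (Digamma (1/2 + u) - Digamma (1/2 - u))"
    by (rule Digamma_diff_sums) (use nz[of 0] in auto)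
  also have "Digamma (1/2 + u) - Digamma (1/2 - u) = of_real pi * tan (of_real pi * u)"
    by (rule Digamma_half_reflection[OF im])
  also have "of_real pi * u = \<i> * z" by (simp add: u_def)
  finally have "(\<lambda>n. (1 / (of_nat n + (1/2 - u)) - 1 / (of_nat n + (1/2 + u))) * (- \<i> / of_real pi)) sums
     (of_real pi * tan (\<i> * z) * (- \<i> / of_real pi))"
    by (rule sums_mult2)
  moreover have "of_real pi * tan (\<i> * z) * (- \<i> / of_real pi) = tanh z"
    by (simp add: tanh_conv_tan)
  moreover have "(1 / (of_nat n + (1/2 - u)) - 1 / (of_nat n + (1/2 + u))) * (- \<i> / of_real pi) =
      2 * z / (z\<^sup>2 + (of_real ((real n + 1/2) * pi))\<^sup>2)" for n
  proof -
    let ?m = "of_nat n + 1/2 :: complex"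
    have "1 / (of_nat n + (1/2 - u)) - 1 / (of_nat n + (1/2 + u)) = 2 * u / ((?m - u) * (?m + u))"
      using nz[of n] by (simp add: divide_simps) (simp add: algebra_simps)
    also have "(?m - u) * (?m + u) = ?m\<^sup>2 - u\<^sup>2" by (simp add: algebra_simps power2_eq_square)
    also have "?m\<^sup>2 - u\<^sup>2 = (z\<^sup>2 + (of_real ((real n + 1/2) * pi))\<^sup>2) / (of_real pi)\<^sup>2"
    proof -
      have "complex_of_real ((real n + 1/2) * pi) = ?m * of_real pi" by simp
      thus ?thesis by (simp add: u_def power_mult_distrib power_divide add_divide_distrib)
    qed
    finally have "1 / (of_nat n + (1/2 - u)) - 1 / (of_nat n + (1/2 + u)) =
      2 * u / ((z\<^sup>2 + (of_real ((real n + 1/2) * pi))\<^sup>2) / (of_real pi)\<^sup>2)" .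
    moreover have "2 * u / (q / (of_real pi)\<^sup>2) * (- \<i> / of_real pi) = 2 * z / q" for q
      by (cases "q = 0") (simp_all add: u_def power2_eq_square divide_simps)
    ultimately show ?thesis by simp
  qed
  ultimately show ?thesis by simp
qed

section \<open>The logarithm of the hyperbolic cosine\<close>

lemma cosh_nonzero:
  assumes "Re z \<noteq> 0"
  shows "cosh z \<noteq> (0::complex)"
proof
  assume "cosh z = 0"
  hence "exp z = - exp (- z)" by (simp add: cosh_field_def add_eq_0_iff)
  hence "norm (exp z) = norm (exp (- z))" by simp
  thus False using assms by simp
qed

text \<open>
  The branch of \<open>ln cosh\<close> on the right half-plane that is real on the real axis. It comes from
  \<open>cosh z = exp z * (1 + exp (- 2 z)) / 2\<close>, where the bracket has positive real part; the
  principal \<open>Ln (cosh z)\<close> would jump.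
\<close>
definition ln_cosh :: "complex \<Rightarrow> complex" where
  "ln_cosh z = z + Ln (1 + exp (- 2 * z)) - of_real (ln 2)"

text \<open>
  The case \<open>z = 0\<close> is included so that \<open>ln_cosh\<close> is differentiable at the left end of the half-line.
\<close>
lemma one_plus_exp_not_nonpos:
  assumes "Re z > 0 \<or> z = 0"
  shows "1 + exp (- 2 * z) \<notin> \<real>\<^sub>\<le>\<^sub>0"
proof -
  have "Re (1 + exp (- 2 * z)) > 0"
  proof (cases "z = 0")
    case False
    hence "Re z > 0" using assms by simp
    hence "norm (exp (- 2 * z)) < 1" by simp
    hence "\<bar>Re (exp (- 2 * z))\<bar> < 1"
      using abs_Re_le_cmod[of "exp (- 2 * z)"] by linarith
    thus ?thesis by (simp add: abs_less_iff)
  qed simp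
  thus ?thesis by (auto simp: complex_nonpos_Reals_iff)
qed

lemma exp_ln_cosh:
  assumes "Re z > 0"
  shows "exp (ln_cosh z) = cosh z"
proof -
  have "1 + exp (- 2 * z) \<noteq> 0" using one_plus_exp_not_nonpos[of z] assms by auto
  moreover have "exp (- 2 * z) = exp (- z) * exp (- z)"
    by (simp flip: exp_add)
  ultimately show ?thesis
    by (simp add: ln_cosh_def exp_diff exp_add exp_of_real cosh_field_def ring_distribs exp_minus)
qed

lemma ln_cosh_0 [simp]: "ln_cosh 0 = 0"
  by (simp add: ln_cosh_def flip: Ln_of_real)

lemma one_minus_tanh:
  assumes "Re z > 0 \<or> z = 0"
  shows "1 - tanh z = 2 * exp (- 2 * z) / (1 + exp (- 2 * z))"
proof -
  have nz: "1 + exp (- 2 * z) \<noteq> 0" using one_plus_exp_not_nonpos[OF assms] by auto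
  have "exp z * exp (- z) = 1" by (simp flip: exp_add)
  moreover have e: "exp (- 2 * z) = exp (- z) * exp (- z)"
    by (simp flip: exp_add)
  ultimately have "exp z * (1 + exp (- 2 * z)) = exp z + exp (- z)"
     "exp z * (1 - exp (- 2 * z)) = exp z - exp (- z)"
    by (simp_all add: ring_distribs flip: mult.assoc)
  hence "tanh z = (1 - exp (- 2 * z)) / (1 + exp (- 2 * z))"
    by (metis exp_not_eq_zero mult_divide_mult_cancel_left tanh_altdef)
  thus ?thesis using nz by (simp add: field_simps)
qed

text \<open>
  Because \<open>tanh z = 1 - 2 exp (- 2 z) / (1 + exp (- 2 z))\<close>.
\<close>
lemma ln_cosh_derivative:
  assumes "Re z > 0 \<or> z = 0"
  shows "(ln_cosh has_field_derivative tanh z) (at z within S)"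
proof -
  have np: "1 + exp (- 2 * z) \<notin> \<real>\<^sub>\<le>\<^sub>0" by (rule one_plus_exp_not_nonpos[OF assms])
  hence nz: "1 + exp (- 2 * z) \<noteq> 0" by auto
  have "1 + (- 2 * exp (- 2 * z)) / (1 + exp (- 2 * z)) = tanh z"
    using one_minus_tanh[OF assms] by (simp add: algebra_simps)
  moreover have "(ln_cosh has_field_derivative 1 + (- 2 * exp (- 2 * z)) / (1 + exp (- 2 * z))) (at z within S)"
    unfolding ln_cosh_def[abs_def] using np
    by (auto intro!: derivative_eq_intros simp: divide_inverse mult_ac)
  ultimately show ?thesis by simp
qed

lemma ln_cosh_tanh_ray_derivative:
  assumes "Re a > 0" "t \<ge> 0"
  shows "((\<lambda>t. ln_cosh (a * of_real t)) has_vector_derivative a * tanh (a * of_real t)) (at t within S)"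
    and "((\<lambda>t. tanh (a * of_real t)) has_vector_derivative a * (1 - tanh (a * of_real t) ^ 2)) (at t within S)"
proof -
  have *: "Re (a * of_real t) > 0 \<or> a * of_real t = 0" using assms by auto
  have c: "cosh (a * of_real t) \<noteq> 0"
    using assms by (cases "t = 0") (simp_all add: cosh_nonzero)
  have "((\<lambda>z. ln_cosh (a * z)) has_field_derivative a * tanh (a * of_real t)) (at (of_real t))"
    by (rule DERIV_cong[OF DERIV_chain2[where f = ln_cosh and g = "\<lambda>z. a * z", OF ln_cosh_derivative[OF *]]])
       (auto intro!: derivative_eq_intros)
  from has_vector_derivative_real_field[OF this]
  show "((\<lambda>t. ln_cosh (a * of_real t)) has_vector_derivative a * tanh (a * of_real t)) (at t within S)" .
  have "((\<lambda>z. tanh (a * z)) has_field_derivative a * (1 - tanh (a * of_real t) ^ 2)) (at (of_real t))"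
    using c by (auto intro!: derivative_eq_intros)
  from has_vector_derivative_real_field[OF this]
  show "((\<lambda>t. tanh (a * of_real t)) has_vector_derivative a * (1 - tanh (a * of_real t) ^ 2)) (at t within S)" .
qed

lemma continuous_on_tanh_ln_cosh_ray:
  assumes "Re a > 0"
  shows "continuous_on {0..} (\<lambda>t. tanh (a * of_real t))"
    and "continuous_on {0..} (\<lambda>t. ln_cosh (a * of_real t))"
  by (auto intro!: continuous_at_imp_continuous_on
        has_vector_derivative_continuous[OF ln_cosh_tanh_ray_derivative(1)[OF assms]]
        has_vector_derivative_continuous[OF ln_cosh_tanh_ray_derivative(2)[OF assms]])

lemma bounded_of_continuous_tendsto:
  fixes f :: "real \<Rightarrow> complex"
  assumes "continuous_on {0..} f" "(f \<longlongrightarrow> l) at_top"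
  obtains C where "\<And>t. t \<ge> 0 \<Longrightarrow> norm (f t) \<le> C"
proof -
  have "\<forall>\<^sub>F t in at_top. dist (f t) l < 1" using assms(2) by (rule tendstoD) simp
  then obtain N where N: "\<And>t. t \<ge> N \<Longrightarrow> dist (f t) l < 1"
    by (auto simp: eventually_at_top_linorder)
  have "compact (f ` {0..max 0 N})"
    by (intro compact_continuous_image continuous_on_subset[OF assms(1)]) auto
  then obtain B where B: "\<And>t. t \<in> {0..max 0 N} \<Longrightarrow> norm (f t) \<le> B"
    by (meson bounded_iff compact_imp_bounded imageI)
  have "norm (f t) \<le> max B (norm l + 1)" if "t \<ge> 0" for t
  proof (cases "t \<le> N")
    case True
    thus ?thesis using B[of t] that by auto
  next
    case False
    hence "dist (f t) l < 1" using N by auto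
    hence "norm (f t) \<le> norm l + 1" using norm_triangle_sub[of "f t" l] by (simp add: dist_norm)
    thus ?thesis by simp
  qed
  thus ?thesis using that by blast
qed

lemma real_exp_decay:
  assumes "(r::real) > 0"
  shows "((\<lambda>t. (1 + t\<^sup>2) * exp (- 2 * (r * t))) \<longlongrightarrow> 0) at_top"
    and "((\<lambda>t. exp (- 2 * (r * t))) \<longlongrightarrow> 0) at_top"
  using assms by real_asymp+

lemma exp_decay:
  assumes "Re a > 0"
  shows "((\<lambda>t. (1 + (of_real t)\<^sup>2) * exp (- 2 * (a * of_real t))) \<longlongrightarrow> 0) at_top"
    and "((\<lambda>t. exp (- 2 * (a * of_real t))) \<longlongrightarrow> 0) at_top"
proof -
  have n: "norm (1 + (of_real t :: complex)\<^sup>2) = 1 + t\<^sup>2" for t :: real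
    using norm_of_real_sum_squares[of 1 t] by simp
  define r where "r = Re a"
  have r: "r > 0" using assms by (simp add: r_def)
  have re: "Re (- 2 * (a * of_real t)) = - 2 * (r * t)" for t by (simp add: r_def)
  show "((\<lambda>t. (1 + (of_real t)\<^sup>2) * exp (- 2 * (a * of_real t))) \<longlongrightarrow> 0) at_top"
    by (rule tendsto_norm_zero_cancel) (simp only: norm_mult n norm_exp_eq_Re re real_exp_decay[OF r])
  show "((\<lambda>t. exp (- 2 * (a * of_real t))) \<longlongrightarrow> 0) at_top"
    by (rule tendsto_norm_zero_cancel) (simp only: norm_exp_eq_Re re real_exp_decay[OF r])
qed

text \<open>
  The bounds behind the integrability claims. Those that matter for large \<open>t\<close> hold because
  \<open>1 - tanh (a t)\<close> and \<open>ln_cosh (a t) - a t + ln 2\<close> decay exponentially and are continuous on the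
  half-line; those that matter for small \<open>t\<close> follow from the zeros of \<open>tanh\<close> and \<open>ln_cosh\<close> at the
  origin and bounds on their derivatives.
\<close>
lemma tanh_ln_cosh_bounds:
  assumes a: "Re a > 0"
  obtains C where "C > 0"
    "\<And>t. t \<ge> 0 \<Longrightarrow> norm (tanh (a * of_real t)) \<le> C * t"
    "\<And>t. t \<ge> 0 \<Longrightarrow> norm (1 - tanh (a * of_real t)) \<le> C / (1 + t\<^sup>2)"
    "\<And>t. t \<ge> 0 \<Longrightarrow> norm (ln_cosh (a * of_real t)) \<le> C * t\<^sup>2"
    "\<And>t. t \<ge> 0 \<Longrightarrow> norm (ln_cosh (a * of_real t) - a * of_real t) \<le> C"
proof -
  have *: "Re (a * of_real t) > 0 \<or> a * of_real t = 0" if "t \<ge> 0" for t using assms that by auto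
  have lim1: "((\<lambda>t. (1 + (of_real t)\<^sup>2) * (1 - tanh (a * of_real t))) \<longlongrightarrow> 2 * 0 / (1 + 0)) at_top"
  proof (rule Lim_transform_eventually)
    show "((\<lambda>t. 2 * ((1 + (of_real t)\<^sup>2) * exp (- 2 * (a * of_real t))) / (1 + exp (- 2 * (a * of_real t))))
       \<longlongrightarrow> 2 * 0 / (1 + 0)) at_top"
      by (intro tendsto_intros exp_decay a) auto
    show "\<forall>\<^sub>F t in at_top. 2 * ((1 + (of_real t)\<^sup>2) * exp (- 2 * (a * of_real t))) / (1 + exp (- 2 * (a * of_real t)))
      = (1 + (of_real t)\<^sup>2) * (1 - tanh (a * of_real t))"
      using eventually_ge_at_top[of 0] by eventually_elim (simp add: one_minus_tanh[OF *])
  qed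
  have lim2: "((\<lambda>t. ln_cosh (a * of_real t) - a * of_real t) \<longlongrightarrow> Ln (1 + 0) - of_real (ln 2)) at_top"
  proof -
    have "((\<lambda>t. Ln (1 + exp (- 2 * (a * of_real t))) - of_real (ln 2)) \<longlongrightarrow> Ln (1 + 0) - of_real (ln 2)) at_top"
      by (intro tendsto_intros exp_decay a) auto
    thus ?thesis by (simp add: ln_cosh_def)
  qed
  obtain C1 where C1: "\<And>t. t \<ge> 0 \<Longrightarrow> norm ((1 + (of_real t)\<^sup>2) * (1 - tanh (a * of_real t))) \<le> C1"
    by (rule bounded_of_continuous_tendsto[OF _ lim1])
       (auto intro!: continuous_intros continuous_on_tanh_ln_cosh_ray[OF a] simp: cosh_nonzero)
  obtain C2 where C2: "\<And>t. t \<ge> 0 \<Longrightarrow> norm (ln_cosh (a * of_real t) - a * of_real t) \<le> C2"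
    by (rule bounded_of_continuous_tendsto[OF _ lim2])
       (auto intro!: continuous_intros continuous_on_tanh_ln_cosh_ray[OF a])
  have n: "norm (1 + (of_real t :: complex)\<^sup>2) = 1 + t\<^sup>2" for t :: real
    using norm_of_real_sum_squares[of 1 t] by simp
  have pos: "1 + t\<^sup>2 > 0" for t :: real by (simp add: add_pos_nonneg)
  have D1: "norm (1 - tanh (a * of_real t)) \<le> C1 / (1 + t\<^sup>2)" if "t \<ge> 0" for t
    using C1[OF that] pos[of t] unfolding norm_mult n by (simp add: pos_le_divide_eq mult.commute)
  have C1pos: "C1 \<ge> 0" using order_trans[OF norm_ge_zero C1[of 0]] by simp
  have D2: "norm (tanh (a * of_real t)) \<le> 1 + C1" if "t \<ge> 0" for t
  proof -
    have "C1 / (1 + t\<^sup>2) \<le> C1 / 1" using C1pos pos[of t] by (intro divide_left_mono) auto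
    with D1[OF that] have "norm (1 - tanh (a * of_real t)) \<le> C1" by simp
    thus ?thesis using norm_triangle_ineq4[of 1 "1 - tanh (a * of_real t)"] by simp
  qed
  define K where "K = norm a * (1 + (1 + C1)\<^sup>2)"
  have D3: "norm (tanh (a * of_real t)) \<le> K * t" if t: "t \<ge> 0" for t
  proof -
    have "norm (tanh (a * of_real t) - tanh (a * of_real 0)) \<le> K * norm (t - 0)"
    proof (rule differentiable_bound[where S = "{0..t}" and f = "\<lambda>t. tanh (a * of_real t)"
        and f' = "\<lambda>s h. h *\<^sub>R (a * (1 - tanh (a * of_real s) ^ 2))" and x = t and y = 0])
      show "((\<lambda>t. tanh (a * of_real t)) has_derivative (\<lambda>h. h *\<^sub>R (a * (1 - tanh (a * of_real s) ^ 2))))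
              (at s within {0..t})" if "s \<in> {0..t}" for s
        using ln_cosh_tanh_ray_derivative(2)[OF a, of s] that
        by (simp add: has_vector_derivative_def)
      show "onorm (\<lambda>h. h *\<^sub>R (a * (1 - tanh (a * of_real s) ^ 2))) \<le> K" if "s \<in> {0..t}" for s
      proof (rule onorm_le)
        fix h :: real
        have "norm (1 - tanh (a * of_real s) ^ 2) \<le> 1 + norm (tanh (a * of_real s)) ^ 2"
          by (metis norm_one norm_power norm_triangle_ineq4)
        also have "\<dots> \<le> 1 + (1 + C1) ^ 2"
          using D2[of s] that by (intro add_left_mono power_mono) auto
        finally have "norm (a * (1 - tanh (a * of_real s) ^ 2)) \<le> K"
          unfolding K_def norm_mult by (rule mult_left_mono) simp
        from mult_right_mono[OF this norm_ge_zero[of h]]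
        show "norm (h *\<^sub>R (a * (1 - tanh (a * of_real s) ^ 2))) \<le> K * norm h"
          by (metis mult.commute norm_scaleR real_norm_def)
      qed
    qed (use t in auto)
    thus ?thesis using t by simp
  qed
  have Kpos: "K \<ge> 0" by (simp add: K_def)
  have D4: "norm (ln_cosh (a * of_real t)) \<le> (norm a * K) * t\<^sup>2" if t: "t \<ge> 0" for t
  proof -
    have "norm (ln_cosh (a * of_real t) - ln_cosh (a * of_real 0)) \<le> (norm a * K * t) * norm (t - 0)"
    proof (rule differentiable_bound[where S = "{0..t}" and f = "\<lambda>t. ln_cosh (a * of_real t)"
        and f' = "\<lambda>s h. h *\<^sub>R (a * tanh (a * of_real s))" and x = t and y = 0])
      show "((\<lambda>t. ln_cosh (a * of_real t)) has_derivative (\<lambda>h. h *\<^sub>R (a * tanh (a * of_real s))))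
              (at s within {0..t})" if "s \<in> {0..t}" for s
        using ln_cosh_tanh_ray_derivative(1)[OF a, of s] that
        by (simp add: has_vector_derivative_def)
      show "onorm (\<lambda>h. h *\<^sub>R (a * tanh (a * of_real s))) \<le> norm a * K * t" if "s \<in> {0..t}" for s
      proof (rule onorm_le)
        fix h :: real
        have "norm (tanh (a * of_real s)) \<le> K * s" using D3 that by auto
        also have "\<dots> \<le> K * t" using that Kpos by (intro mult_left_mono) auto
        finally have "norm (a * tanh (a * of_real s)) \<le> norm a * K * t"
          unfolding norm_mult mult.assoc by (rule mult_left_mono) simp
        from mult_right_mono[OF this norm_ge_zero[of h]]
        show "norm (h *\<^sub>R (a * tanh (a * of_real s))) \<le> norm a * K * t * norm h"
          by (metis mult.commute norm_scaleR real_norm_def)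
      qed
    qed (use t in auto)
    thus ?thesis using t by (simp add: power2_eq_square mult_ac)
  qed
  define C where "C = 1 + C1 + K + norm a * K + \<bar>C2\<bar>"
  have le: "C1 \<le> C" "K \<le> C" "norm a * K \<le> C" "C2 \<le> C" "C > 0"
    using C1pos Kpos mult_nonneg_nonneg[OF norm_ge_zero[of a] Kpos] unfolding C_def by linarith+
  show ?thesis
  proof (rule that[of C])
    fix t :: real assume t: "t \<ge> 0"
    show "norm (tanh (a * of_real t)) \<le> C * t"
      using D3[OF t] mult_right_mono[OF le(2) t] by linarith
    show "norm (1 - tanh (a * of_real t)) \<le> C / (1 + t\<^sup>2)"
      using D1[OF t] divide_right_mono[OF le(1) less_imp_le[OF pos]] by (rule order_trans)
    show "norm (ln_cosh (a * of_real t)) \<le> C * t\<^sup>2"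
      using D4[OF t] mult_right_mono[OF le(3), of "t\<^sup>2"] by simp
    show "norm (ln_cosh (a * of_real t) - a * of_real t) \<le> C"
      using C2[OF t] le by linarith
  qed (use le in auto)
qed

section \<open>The rational kernel and the digamma function\<close>

text \<open>
  With \<open>c n = (n + 1/2) pi / a\<close>, the partial fractions of \<open>tanh (a t)\<close> have the denominators
  \<open>t\<^sup>2 + (c n)\<^sup>2\<close>. For \<open>x = a w / pi\<close>, the \<open>n\<close>-th term integrates to \<open>1 / (n + 1/2) - 1 / (n + 1/2 + x)\<close>.
\<close>
lemma tanh_kernel_integral:
  assumes a: "Re a > 0" and w: "w > 0"
  shows "half_line_integral (\<lambda>t. tanh (a * of_real t) * of_real (w\<^sup>2 / (t * (t\<^sup>2 + w\<^sup>2))))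
           (Digamma (1/2 + a * of_real w / of_real pi) - Digamma (1/2))"
proof -
  have a0: "a \<noteq> 0" using a by auto
  define \<rho> where "\<rho> = pi * (Re a / ((Re a)\<^sup>2 + (Im a)\<^sup>2))"
  have \<rho>: "\<rho> > 0" using a by (simp add: \<rho>_def add_pos_nonneg)
  define c where "c = (\<lambda>n. of_real ((real n + 1/2) * pi) / a)"
  have Re_c: "Re (c n) = (1/2 + real n) * \<rho>" for n
    by (simp add: c_def \<rho>_def Re_divide add.commute)
  have c: "Re (c n) > 0" for n unfolding Re_c using \<rho> by (intro mult_pos_pos) auto
  define K where "K = 2 * (of_real w)\<^sup>2 / a"
  define R where "R = (\<lambda>n t. 1 / (((of_real t)\<^sup>2 + (c n)\<^sup>2) * ((of_real t)\<^sup>2 + (of_real w)\<^sup>2)))"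
  define D where "D = (\<lambda>n. norm K / \<rho>\<^sup>2 * inverse ((1/2 + real n)\<^sup>2))"
  define x where "x = a * of_real w / of_real pi"
  have x: "Re x > 0" using a w by (simp add: x_def)
  show ?thesis unfolding x_def[symmetric]
  proof (rule half_line_integral_sums[where f = "\<lambda>n t. K * R n t" and D = D])
    show "half_line_integral (\<lambda>t. K * R n t)
            (K * (of_real pi / (2 * c n * of_real w * (c n + of_real w))))" for n
      unfolding R_def by (intro half_line_integral_cmult rational_product_integral c w)
    show "norm (K * R n t) \<le> D n * (1 / (t\<^sup>2 + w\<^sup>2))" for n t
    proof -
      have "norm (R n t) \<le> 1 / (Re (c n))\<^sup>2 * (1 / (t\<^sup>2 + w\<^sup>2))"
        unfolding R_def by (rule rational_product_integrable(2)[OF c w])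
      from mult_left_mono[OF this norm_ge_zero[of K]]
      have "norm (K * R n t) \<le> norm K * (1 / (Re (c n))\<^sup>2 * (1 / (t\<^sup>2 + w\<^sup>2)))"
        by (simp only: norm_mult)
      also have "norm K * (1 / (Re (c n))\<^sup>2 * (1 / (t\<^sup>2 + w\<^sup>2))) = D n * (1 / (t\<^sup>2 + w\<^sup>2))"
      proof -
        have "k * (1 / (m * r) * (1 / q)) = k / r * inverse m * (1 / q)" for k m r q :: real
          by (simp add: inverse_eq_divide)
        thus ?thesis unfolding D_def Re_c power_mult_distrib by this
      qed
      finally show ?thesis .
    qed
    show "summable D" unfolding D_def
      by (intro summable_mult Polygamma_converges') auto
    show "D n \<ge> 0" for n by (simp add: D_def)
    show "set_integrable lborel {0<..} (\<lambda>t::real. 1 / (t\<^sup>2 + w\<^sup>2))"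
      by (rule inverse_sum_squares_integral(1)[OF w])
    show "(\<lambda>n. K * R n t) sums (tanh (a * of_real t) * of_real (w\<^sup>2 / (t * (t\<^sup>2 + w\<^sup>2))))"
      if t: "t > 0" for t
    proof -
      have "Re (a * of_real t) \<noteq> 0" using a t by simp
      from sums_mult2[OF tanh_partial_fractions[OF this], of "of_real (w\<^sup>2 / (t * (t\<^sup>2 + w\<^sup>2)))"]
      have "(\<lambda>n. 2 * (a * of_real t) / ((a * of_real t)\<^sup>2 + (of_real ((real n + 1/2) * pi))\<^sup>2) *
              of_real (w\<^sup>2 / (t * (t\<^sup>2 + w\<^sup>2)))) sums
            (tanh (a * of_real t) * of_real (w\<^sup>2 / (t * (t\<^sup>2 + w\<^sup>2))))" .
      moreover have "2 * (a * of_real t) / ((a * of_real t)\<^sup>2 + (of_real ((real n + 1/2) * pi))\<^sup>2) *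
              of_real (w\<^sup>2 / (t * (t\<^sup>2 + w\<^sup>2))) = K * R n t" for n
      proof -
        have "of_real ((real n + 1/2) * pi) = a * c n" using a0 by (simp add: c_def)
        hence "(a * of_real t)\<^sup>2 + (of_real ((real n + 1/2) * pi))\<^sup>2 = a\<^sup>2 * ((of_real t)\<^sup>2 + (c n)\<^sup>2)"
          by (simp only: power_mult_distrib ring_distribs)
        moreover have "2 * (a * of_real t) / (a\<^sup>2 * q) * of_real (w\<^sup>2 / (t * (t\<^sup>2 + w\<^sup>2))) =
             K * (1 / (q * ((of_real t)\<^sup>2 + (of_real w)\<^sup>2)))" for q
          using a0 t by (simp add: K_def power2_eq_square)
        ultimately show ?thesis by (simp only: R_def)
      qed
      ultimately show ?thesis by simp
    qed
    have "(\<lambda>n. 1 / (of_nat n + 1/2) - 1 / (of_nat n + (1/2 + x))) sums (Digamma (1/2 + x) - Digamma (1/2))"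
      using x by (intro Digamma_diff_sums) (auto simp: complex_eq_iff)
    moreover have "K * (of_real pi / (2 * c n * of_real w * (c n + of_real w))) =
        1 / (of_nat n + 1/2) - 1 / (of_nat n + (1/2 + x))" for n
    proof -
      let ?m = "of_nat n + 1/2 :: complex"
      have nz: "?m \<noteq> 0" "?m + x \<noteq> 0" using x by (auto simp: complex_eq_iff)
      define k where "k = of_real pi / a"
      have k: "k \<noteq> 0" "of_real pi = a * k" "of_real w = k * x" "c n = k * ?m" and x0: "x \<noteq> 0"
        using a0 x by (auto simp: k_def x_def c_def)
      have "k * ?m + k * x = k * (?m + x)" by (simp add: distrib_left)
      hence "K * (of_real pi / (2 * c n * of_real w * (c n + of_real w))) =
          2 * (k * x)\<^sup>2 / a * (a * k / (2 * (k * ?m) * (k * x) * (k * (?m + x))))"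
        by (simp only: K_def k)
      also have "\<dots> = x / (?m * (?m + x))"
      proof -
        have "2 * (k * x)\<^sup>2 / a * (a * k / (2 * (k * m) * (k * x) * (k * q))) = x / (m * q)" for m q
          using a0 k(1) x0 by (simp add: power2_eq_square)
        thus ?thesis by this
      qed
      also have "\<dots> = 1 / ?m - 1 / (?m + x)"
        using nz by (simp add: divide_simps)
      finally show ?thesis by (simp add: add.assoc)
    qed
    ultimately show "(\<lambda>n. K * (of_real pi / (2 * c n * of_real w * (c n + of_real w)))) sums
       (Digamma (1/2 + x) - Digamma (1/2))" by simp
  qed
qed

section \<open>Asymptotics of the digamma function and the regularised integral\<close>

lemma Digamma_one_half_complex: "Digamma (1/2 :: complex) = - euler_mascheroni - of_real (ln 4)"
  using ln_realpow[of 2 2] by (simp add: Digamma_one_half)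

text \<open>
  The mean value inequality for \<open>Ln u - u / (p + 1/2)\<close> on the segment from \<open>p\<close> to \<open>p + 1\<close>.
\<close>
lemma Ln_step_bound:
  assumes p: "Re p > 0"
  shows "norm (Ln (p + 1) - Ln p - inverse (p + 1/2)) \<le> 1 / (Re p)\<^sup>2"
proof -
  let ?q = "p + 1/2"
  have q: "?q \<noteq> 0" using p by (auto simp: complex_eq_iff)
  have "norm ((Ln (p + 1) - (p + 1) / ?q) - (Ln p - p / ?q)) \<le> 1 / (Re p)\<^sup>2 * norm (p + 1 - p)"
  proof (rule field_differentiable_bound[where S = "closed_segment p (p + 1)"
       and f = "\<lambda>u. Ln u - u / ?q" and f' = "\<lambda>u. 1 / u - 1 / ?q"])
    fix u assume "u \<in> closed_segment p (p + 1)"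
    then obtain s where s: "0 \<le> s" "s \<le> 1" "u = p + of_real s"
      by (auto simp: in_segment algebra_simps scaleR_conv_of_real)
    have Reu: "Re u \<ge> Re p" using s by simp
    hence u: "u \<noteq> 0" "u \<notin> \<real>\<^sub>\<le>\<^sub>0" using p by (auto simp: complex_nonpos_Reals_iff)
    show "((\<lambda>u. Ln u - u / ?q) has_field_derivative 1 / u - 1 / ?q) (at u within closed_segment p (p + 1))"
      using u q by (auto intro!: derivative_eq_intros simp: inverse_eq_divide)
    have "1 / u - 1 / ?q = of_real (1/2 - s) / (u * ?q)"
      using u q by (simp add: divide_simps s(3)) (simp add: algebra_simps)
    hence "norm (1 / u - 1 / ?q) = \<bar>1/2 - s\<bar> / (norm u * norm ?q)"
      by (simp only: norm_divide norm_mult norm_of_real)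
    also have "\<dots> \<le> 1 / (Re p * Re p)"
    proof (rule frac_le)
      show "Re p * Re p \<le> norm u * norm ?q"
        using complex_Re_le_cmod[of u] complex_Re_le_cmod[of ?q] Reu p by (intro mult_mono) auto
    qed (use s p in auto)
    finally show "norm (1 / u - 1 / ?q) \<le> 1 / (Re p)\<^sup>2" by (simp add: power2_eq_square)
  qed auto
  moreover have "(Ln (p + 1) - (p + 1) / ?q) - (Ln p - p / ?q) = Ln (p + 1) - Ln p - inverse ?q"
  proof -
    have *: "(p + 1) / q = p / q + inverse q" for q
      by (simp add: add_divide_distrib inverse_eq_divide)
    have alg: "A - (B + C) - (D - B) = A - D - C" for A B C D :: complex by simp
    from * have e: "(p + 1) / ?q = p / ?q + inverse ?q" by this
    show ?thesis unfolding e by (rule alg)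
  qed
  ultimately show ?thesis by simp
qed

text \<open>
  The limit \<open>ln m - (\<Sum>n<m. 1 / (1/2 + z + n))\<close> that defines the digamma function is compared with
  the telescoping sum of \<open>Ln (z + n + 1) - Ln (z + n)\<close>. By \<open>Ln_step_bound\<close> the error is at most
  the sum of \<open>1 / (Re z + n)\<^sup>2\<close>, itself below a telescoping sum with value \<open>1 / (Re z - 1)\<close>.
\<close>
lemma Digamma_half_shift_asymptotic:
  assumes z: "Re z > 1"
  shows "norm (Digamma (1/2 + z) - Ln z) \<le> 1 / (Re z - 1)"
proof -
  define d where "d = (\<lambda>n. Ln (z + of_nat n + 1) - Ln (z + of_nat n) - inverse (z + of_nat n + 1/2))"
  have partial: "(\<Sum>n<m. norm (d n)) \<le> 1 / (Re z - 1) - 1 / (Re z + real m - 1)" for m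
  proof (induction m)
    case (Suc m)
    define r where "r = Re z + real m"
    have r: "r > 1" using z by (simp add: r_def)
    have "norm (d m) \<le> 1 / r\<^sup>2"
      unfolding d_def r_def using Ln_step_bound[of "z + of_nat m"] z by simp
    also have "\<dots> \<le> 1 / ((r - 1) * r)"
      using r by (intro divide_left_mono) (auto simp: power2_eq_square)
    also have "\<dots> = 1 / (r - 1) - 1 / r" using r by (simp add: field_simps)
    finally show ?case using Suc.IH by (simp add: r_def algebra_simps)
  qed auto
  have "(\<lambda>m. (of_real (ln (real m)) - (\<Sum>n<m. inverse (1/2 + z + of_nat n))) + Ln (1 + z / of_nat m) - Ln z)
          \<longlonglongrightarrow> Digamma (1/2 + z) + Ln (1 + 0) - Ln z"
    using z by (intro tendsto_intros Digamma_LIMSEQ tendsto_divide_0[OF tendsto_const]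
                 tendsto_of_nat) (auto simp: complex_eq_iff)
  moreover have "\<forall>\<^sub>F m in sequentially. (of_real (ln (real m)) - (\<Sum>n<m. inverse (1/2 + z + of_nat n)))
        + Ln (1 + z / of_nat m) - Ln z = (\<Sum>n<m. d n)"
    using eventually_gt_at_top[of 0]
  proof eventually_elim
    case (elim m)
    have "1 + z / of_nat m \<noteq> 0" using z elim
      by (auto simp: field_simps complex_eq_iff)
    moreover have "z + of_nat m = of_real (real m) * (1 + z / of_nat m)" using elim by (simp add: field_simps)
    ultimately have "Ln (z + of_nat m) = of_real (ln (real m)) + Ln (1 + z / of_nat m)"
      using elim Ln_times_of_real[of "real m" "1 + z / of_nat m"] by simp
    moreover have "(\<Sum>n<m. Ln (z + of_nat n + 1) - Ln (z + of_nat n)) = Ln (z + of_nat m) - Ln z"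
      using sum_lessThan_telescope[of "\<lambda>n. Ln (z + of_nat n)" m] by (simp add: algebra_simps)
    ultimately show ?case
      unfolding d_def sum_subtractf by (simp add: add_ac)
  qed
  ultimately have lim: "(\<lambda>m. \<Sum>n<m. d n) \<longlonglongrightarrow> Digamma (1/2 + z) - Ln z"
    by (simp add: tendsto_cong)
  show ?thesis
  proof (rule Lim_norm_ubound[OF _ lim])
    have "norm (\<Sum>n<m. d n) \<le> 1 / (Re z - 1)" for m
    proof -
      have "norm (\<Sum>n<m. d n) \<le> (\<Sum>n<m. norm (d n))" by (rule norm_sum)
      also have "\<dots> \<le> 1 / (Re z - 1)" using partial[of m] z
        by (smt (verit) of_nat_0_le_iff divide_nonneg_nonneg)
      finally show ?thesis .
    qed
    thus "\<forall>\<^sub>F m in sequentially. norm (\<Sum>n<m. d n) \<le> 1 / (Re z - 1)" by simp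
  qed simp
qed

lemma rational_difference_integral:
  assumes w: "0 < w" "w \<le> v"
  shows "half_line_integral (\<lambda>t. of_real (t / (t\<^sup>2 + w\<^sup>2)) - of_real (t / (t\<^sup>2 + v\<^sup>2)))
           (of_real (ln v - ln w))"
proof -
  have v: "v > 0" using w by simp
  have pos: "t\<^sup>2 + r\<^sup>2 > 0" if "r > 0" for t r :: real using that by (simp add: add_nonneg_pos)
  have nz: "t\<^sup>2 + r\<^sup>2 \<noteq> 0" if "r > 0" for t r :: real using pos[OF that, of t] by linarith
  let ?F = "\<lambda>t. (ln (t\<^sup>2 + w\<^sup>2) - ln (t\<^sup>2 + v\<^sup>2)) / 2"
  have D: "(?F has_real_derivative t / (t\<^sup>2 + w\<^sup>2) - t / (t\<^sup>2 + v\<^sup>2)) (at t)" for t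
    using pos[OF w(1), of t] pos[OF v, of t]
    by (auto intro!: derivative_eq_intros simp: divide_simps)
  have cont: "continuous_on {0<..} (\<lambda>t::real. t / (t\<^sup>2 + w\<^sup>2) - t / (t\<^sup>2 + v\<^sup>2))"
    using nz[OF w(1)] nz[OF v] by (intro continuous_intros) auto
  have nn: "t / (t\<^sup>2 + w\<^sup>2) - t / (t\<^sup>2 + v\<^sup>2) \<ge> 0" if "t > 0" for t
  proof -
    have "t\<^sup>2 + w\<^sup>2 \<le> t\<^sup>2 + v\<^sup>2" using w by (intro add_left_mono power_mono) auto
    hence "t / (t\<^sup>2 + v\<^sup>2) \<le> t / (t\<^sup>2 + w\<^sup>2)"
      using that pos[OF w(1), of t] pos[OF v, of t] by (intro divide_left_mono) auto
    thus ?thesis by simp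
  qed
  have A: "(?F \<longlongrightarrow> (ln (0\<^sup>2 + w\<^sup>2) - ln (0\<^sup>2 + v\<^sup>2)) / 2) (at_right 0)"
    using w v by (intro tendsto_intros) auto
  have B: "(?F \<longlongrightarrow> 0) at_top" using w(1) v by real_asymp
  have "half_line_integral (\<lambda>t. of_real (t / (t\<^sup>2 + w\<^sup>2) - t / (t\<^sup>2 + v\<^sup>2)))
      (of_real (0 - (ln (0\<^sup>2 + w\<^sup>2) - ln (0\<^sup>2 + v\<^sup>2)) / 2))"
    by (intro half_line_integral_of_real half_line_integral_FTC_nonneg[OF D cont nn A B])
  thus ?thesis
  proof (rule half_line_integral_cong)
    have "0 - (ln (0\<^sup>2 + w\<^sup>2) - ln (0\<^sup>2 + v\<^sup>2)) / 2 = ln v - ln w"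
      using w v by (simp add: ln_realpow diff_divide_distrib)
    thus "complex_of_real (0 - (ln (0\<^sup>2 + w\<^sup>2) - ln (0\<^sup>2 + v\<^sup>2)) / 2) = of_real (ln v - ln w)"
      by (simp only:)
  qed (simp only: of_real_diff)
qed

text \<open>
  The integral equals \<open>K w - Q w\<close>, with \<open>K w\<close> from \<open>tanh_kernel_integral\<close> and \<open>Q w\<close> the integral of
  \<open>(1 - tanh (a t)) * t / (t\<^sup>2 + w\<^sup>2)\<close>. Since its dependence on \<open>w\<close> is known exactly from
  \<open>rational_difference_integral\<close>, it is determined by its behaviour for large \<open>w\<close>, where \<open>Q\<close>
  vanishes and the digamma function is asymptotically a logarithm.
\<close>
lemma tanh_minus_rational_integral:
  assumes a: "Re a > 0" and w: "w > 0"
  shows "half_line_integral (\<lambda>t. tanh (a * of_real t) / of_real t - of_real (t / (t\<^sup>2 + w\<^sup>2)))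
           (euler_mascheroni + Ln (4 * a * of_real w / of_real pi))"
proof -
  obtain C where C: "C > 0" "\<And>t. t \<ge> 0 \<Longrightarrow> norm (1 - tanh (a * of_real t)) \<le> C / (1 + t\<^sup>2)"
    using tanh_ln_cosh_bounds[OF a] by metis
  let ?h = "\<lambda>v t. (1 - tanh (a * of_real t)) * of_real (t / (t\<^sup>2 + v\<^sup>2))"
  define Q where "Q = (\<lambda>v. LINT t:{0<..}|lborel. ?h v t)"
  have tail: "set_integrable lborel {0<..} (\<lambda>t::real. C / (2 * v) * (1 / (t\<^sup>2 + 1\<^sup>2)))" for v
    by (intro set_integrable_mult_right inverse_sum_squares_integral) simp
  \<comment> \<open>The arithmetic-geometric mean inequality bounds \<open>t / (t\<^sup>2 + v\<^sup>2)\<close> by \<open>1 / (2 v)\<close>.\<close>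
  have bnd: "norm (?h v t) \<le> C / (2 * v) * (1 / (t\<^sup>2 + 1\<^sup>2))" if "v > 0" "t > 0" for v t
  proof -
    have pos: "t\<^sup>2 + v\<^sup>2 > 0" using that by (simp add: add_nonneg_pos)
    have "2 * v * t \<le> t\<^sup>2 + v\<^sup>2" using zero_le_power2[of "t - v"] by (simp add: power2_diff mult_ac)
    hence "t / (t\<^sup>2 + v\<^sup>2) \<le> 1 / (2 * v)" using pos that by (simp add: field_simps)
    moreover have "norm (1 - tanh (a * of_real t)) \<le> C / (1 + t\<^sup>2)" using C that by simp
    moreover have "t / (t\<^sup>2 + v\<^sup>2) \<ge> 0" using that pos by simp
    ultimately have "norm (1 - tanh (a * of_real t)) * (t / (t\<^sup>2 + v\<^sup>2)) \<le> C / (1 + t\<^sup>2) * (1 / (2 * v))"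
      using C(1) by (intro mult_mono) (auto intro!: divide_nonneg_nonneg add_nonneg_nonneg)
    thus ?thesis using \<open>t / (t\<^sup>2 + v\<^sup>2) \<ge> 0\<close>
      unfolding norm_mult norm_of_real using that by (simp add: add.commute mult.commute)
  qed
  have Q: "half_line_integral (?h v) (Q v)" if v: "v > 0" for v
  proof -
    have "t\<^sup>2 + v\<^sup>2 \<noteq> 0" for t using v by (simp add: add_nonneg_eq_0_iff)
    hence "continuous_on {0<..} (?h v)"
      by (intro continuous_intros continuous_on_subset[OF continuous_on_tanh_ln_cosh_ray(1)[OF a]]) auto
    thus ?thesis unfolding half_line_integral_iff Q_def
      using half_line_integrable_bound[OF _ tail bnd[OF v]] by simp
  qed
  have Qbnd: "norm (Q v) \<le> C * pi / 4 * (1 / v)" if "v > 0" for v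
  proof -
    have "norm (Q v) \<le> (LINT t:{0<..}|lborel. C / (2 * v) * (1 / (t\<^sup>2 + 1\<^sup>2)))"
      by (rule half_line_integral_norm_le[OF Q tail bnd]) (use that in auto)
    also have "\<dots> = C / (2 * v) * (pi / 2 / 1)"
      using inverse_sum_squares_integral(2)[of 1] by (simp only: set_integral_mult_right)
    finally show ?thesis by (simp add: field_simps)
  qed
  have I: "half_line_integral (\<lambda>t. tanh (a * of_real t) / of_real t - of_real (t / (t\<^sup>2 + v\<^sup>2)))
       (Digamma (1/2 + a * of_real v / of_real pi) - Digamma (1/2) - Q v)" if v: "v > 0" for v
  proof (rule half_line_integral_cong[OF half_line_integral_diff[OF tanh_kernel_integral[OF a v] Q[OF v]]])
    fix t :: real assume t: "t > 0"
    have "t\<^sup>2 + v\<^sup>2 \<noteq> 0" using v by (simp add: add_nonneg_eq_0_iff)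
    hence "v\<^sup>2 / (t * (t\<^sup>2 + v\<^sup>2)) = 1 / t - t / (t\<^sup>2 + v\<^sup>2)"
      using t by (simp add: field_simps power2_eq_square)
    hence e: "complex_of_real (v\<^sup>2 / (t * (t\<^sup>2 + v\<^sup>2))) = 1 / of_real t - of_real (t / (t\<^sup>2 + v\<^sup>2))"
      by (metis of_real_1 of_real_diff of_real_divide)
    show "tanh (a * of_real t) * of_real (v\<^sup>2 / (t * (t\<^sup>2 + v\<^sup>2))) - ?h v t =
        tanh (a * of_real t) / of_real t - of_real (t / (t\<^sup>2 + v\<^sup>2))"
    proof -
      have "T * (1 / u - x) - (1 - T) * x = T / u - x" for T u x :: complex
        by (simp add: algebra_simps)
      thus ?thesis unfolding e by this
    qed
  qed simp
  define J where "J = Digamma (1/2 + a * of_real w / of_real pi) - Digamma (1/2) - Q w"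
  \<comment> \<open>The parameter is moved from \<open>w\<close> to an arbitrary \<open>v \<ge> w\<close>, so that \<open>v\<close> can tend to infinity.\<close>
  have J: "J = (Digamma (1/2 + a * of_real v / of_real pi) - Ln (a * of_real v / of_real pi)) - Q v
       + (Ln (a / of_real pi) - Digamma (1/2) + of_real (ln w))" if v: "v \<ge> w" for v
  proof -
    have v0: "v > 0" using v w by simp
    have "half_line_integral (\<lambda>t. tanh (a * of_real t) / of_real t - of_real (t / (t\<^sup>2 + v\<^sup>2)))
       (J + of_real (ln v - ln w))"
      by (rule half_line_integral_cong[OF half_line_integral_add[OF I[OF w] rational_difference_integral[OF w v]]])
         (auto simp: J_def)
    with I[OF v0] have "J + of_real (ln v - ln w) =
       Digamma (1/2 + a * of_real v / of_real pi) - Digamma (1/2) - Q v"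
      by (rule half_line_integral_unique[symmetric])
    moreover have "Ln (a * of_real v / of_real pi) = of_real (ln v) + Ln (a / of_real pi)"
    proof -
      have "a / of_real pi \<noteq> 0" using a by auto
      from Ln_times_of_real[OF v0 this] show ?thesis by (simp add: mult.commute Ln_of_real[OF v0])
    qed
    ultimately show ?thesis by (simp add: algebra_simps)
  qed
  have "((\<lambda>v. (Digamma (1/2 + a * of_real v / of_real pi) - Ln (a * of_real v / of_real pi)) - Q v
       + (Ln (a / of_real pi) - Digamma (1/2) + of_real (ln w))) \<longlongrightarrow>
     0 - 0 + (Ln (a / of_real pi) - Digamma (1/2) + of_real (ln w))) at_top"
  proof (intro tendsto_intros)
    define r where "r = Re a / pi"
    have r: "r > 0" using a by (simp add: r_def)
    have re: "Re (a * of_real v / of_real pi) = r * v" for v by (simp add: r_def)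
    show "((\<lambda>v. Digamma (1/2 + a * of_real v / of_real pi) - Ln (a * of_real v / of_real pi)) \<longlongrightarrow> 0) at_top"
    proof (rule Lim_null_comparison)
      show "\<forall>\<^sub>F v in at_top. norm (Digamma (1/2 + a * of_real v / of_real pi) - Ln (a * of_real v / of_real pi))
         \<le> 1 / (r * v - 1)"
        using eventually_gt_at_top[of "1 / r"]
      proof eventually_elim
        case (elim v)
        hence "Re (a * of_real v / of_real pi) > 1" unfolding re using r by (simp add: field_simps)
        from Digamma_half_shift_asymptotic[OF this] show ?case unfolding re .
      qed
      show "((\<lambda>v. 1 / (r * v - 1)) \<longlongrightarrow> 0) at_top"
        by (intro tendsto_divide_0[OF tendsto_const] filterlim_at_top_imp_at_infinity
             filterlim_tendsto_add_at_top[OF tendsto_const[of "-1"], simplified add.commute, simplified]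
             filterlim_tendsto_pos_mult_at_top[OF tendsto_const r filterlim_ident])
    qed
    show "(Q \<longlongrightarrow> 0) at_top"
    proof (rule Lim_null_comparison)
      show "\<forall>\<^sub>F v in at_top. norm (Q v) \<le> C * pi / 4 * (1 / v)"
        using eventually_gt_at_top[of 0] by eventually_elim (rule Qbnd)
      have "((\<lambda>v. C * pi / 4 * (1 / v)) \<longlongrightarrow> C * pi / 4 * 0) at_top"
        by (intro tendsto_intros tendsto_divide_0[OF tendsto_const] filterlim_at_top_imp_at_infinity filterlim_ident)
      thus "((\<lambda>v. C * pi / 4 * (1 / v)) \<longlongrightarrow> 0) at_top" by simp
    qed
  qed
  moreover have "\<forall>\<^sub>F v in at_top. (Digamma (1/2 + a * of_real v / of_real pi) - Ln (a * of_real v / of_real pi)) - Q v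
       + (Ln (a / of_real pi) - Digamma (1/2) + of_real (ln w)) = J"
    using eventually_ge_at_top[of w] by eventually_elim (rule J[symmetric])
  ultimately have "((\<lambda>v. J) \<longlongrightarrow> 0 - 0 + (Ln (a / of_real pi) - Digamma (1/2) + of_real (ln w))) (at_top :: real filter)"
    by (rule Lim_transform_eventually)
  hence "J = Ln (a / of_real pi) - Digamma (1/2) + of_real (ln w)"
    by (simp add: tendsto_const_iff)
  also have "Digamma (1/2 :: complex) = - euler_mascheroni - of_real (ln 4)"
    by (rule Digamma_one_half_complex)
  also have "Ln (a / of_real pi) - (- euler_mascheroni - of_real (ln 4)) + of_real (ln w) =
      euler_mascheroni + (of_real (ln (4 * w)) + Ln (a / of_real pi))"
    using w by (simp add: ln_mult)
  also have "of_real (ln (4 * w)) + Ln (a / of_real pi) = Ln (4 * a * of_real w / of_real pi)"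
  proof -
    have nz: "a / of_real pi \<noteq> 0" "4 * w > 0" using a w by auto
    have "complex_of_real (4 * w) * (a / of_real pi) = 4 * a * of_real w / of_real pi" by simp
    thus ?thesis using Ln_times_of_real[OF nz(2,1)] Ln_of_real[OF nz(2)] by (simp only:)
  qed
  finally show ?thesis using I[OF w] by (simp add: J_def)
qed

section \<open>Replacing the rational kernel by an arctangent, and tanh by ln cosh\<close>

text \<open>
  The integrand is the derivative of \<open>t * arctan (y / t) / y\<close>, which rises from \<open>0\<close> to \<open>1\<close>.
\<close>
lemma arctan_minus_rational_integral:
  assumes y: "y > 0"
  shows "half_line_integral (\<lambda>t. of_real (1 / y * arctan (y / t)) - of_real (t / (t\<^sup>2 + y\<^sup>2))) 1"
proof -
  have pos: "t\<^sup>2 + y\<^sup>2 > 0" for t using y by (simp add: add_nonneg_pos)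
  have nz: "t\<^sup>2 + y\<^sup>2 \<noteq> 0" for t using pos[of t] by linarith
  let ?F = "\<lambda>t. t * (1 / y * arctan (y / t))"
  have D: "(?F has_real_derivative 1 / y * arctan (y / t) - t / (t\<^sup>2 + y\<^sup>2)) (at t)" if t: "t > 0" for t
  proof -
    have e: "1 + (y / t)\<^sup>2 = (t\<^sup>2 + y\<^sup>2) / t\<^sup>2" using t by (simp add: field_simps)
    have "(?F has_real_derivative 1 / y * arctan (y / t) + t * (1 / y * (- (y / t\<^sup>2) / (1 + (y / t)\<^sup>2)))) (at t)"
      using t by (auto intro!: derivative_eq_intros simp: power2_eq_square divide_inverse)
    also have "t * (1 / y * (- (y / t\<^sup>2) / (1 + (y / t)\<^sup>2))) = - (t / (t\<^sup>2 + y\<^sup>2))"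
      unfolding e using t y nz[of t] by simp
    finally show ?thesis by simp
  qed
  have cont: "continuous_on {0<..} (\<lambda>t. 1 / y * arctan (y / t) - t / (t\<^sup>2 + y\<^sup>2))"
    using nz y by (intro continuous_intros) auto
  have nn: "1 / y * arctan (y / t) - t / (t\<^sup>2 + y\<^sup>2) \<ge> 0" if t: "t > 0" for t
  proof -
    let ?x = "y / t"
    define G where "G = (\<lambda>x. arctan x - x / (1 + x\<^sup>2))"
    have "G 0 \<le> G ?x"
    proof (rule DERIV_nonneg_imp_nondecreasing[where f = G and a = 0 and b = ?x])
      fix x :: real
      have px: "1 + x\<^sup>2 > 0" by (simp add: add_pos_nonneg)
      have "(G has_real_derivative 1 / (1 + x\<^sup>2) - ((1 + x\<^sup>2) - x * (2 * x)) / ((1 + x\<^sup>2) * (1 + x\<^sup>2))) (at x)"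
        unfolding G_def using px by (auto intro!: derivative_eq_intros simp: inverse_eq_divide)
      moreover have "1 / (1 + x\<^sup>2) - ((1 + x\<^sup>2) - x * (2 * x)) / ((1 + x\<^sup>2) * (1 + x\<^sup>2)) = 2 * x\<^sup>2 / (1 + x\<^sup>2)\<^sup>2"
        using px by (simp add: divide_simps power2_eq_square)
      ultimately show "\<exists>y. DERIV G x :> y \<and> y \<ge> 0" by auto
    qed (use t y in simp)
    hence "?x / (1 + ?x\<^sup>2) \<le> arctan ?x" by (simp add: G_def)
    hence "1 / y * (?x / (1 + ?x\<^sup>2)) \<le> 1 / y * arctan ?x" using y by (intro mult_left_mono) auto
    moreover have "1 / y * (?x / (1 + ?x\<^sup>2)) = t / (t\<^sup>2 + y\<^sup>2)"
    proof -
      have e: "1 + (y / t)\<^sup>2 = (t\<^sup>2 + y\<^sup>2) / t\<^sup>2" using t by (simp add: field_simps)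
      show ?thesis unfolding e using t y nz[of t] by (simp add: power2_eq_square)
    qed
    ultimately show ?thesis by simp
  qed
  have A: "(?F \<longlongrightarrow> 0) (at_right 0)" using y by real_asymp
  have B: "(?F \<longlongrightarrow> 1) at_top" using y by real_asymp
  have "half_line_integral (\<lambda>t. of_real (1 / y * arctan (y / t) - t / (t\<^sup>2 + y\<^sup>2))) (of_real (1 - 0))"
    by (intro half_line_integral_of_real half_line_integral_FTC_nonneg[OF D cont nn A B])
  thus ?thesis by (rule half_line_integral_cong) (simp_all only: of_real_diff of_real_1 of_real_0 diff_zero)
qed

text \<open>
  The integrand is the derivative of \<open>- ln_cosh (a t) / (a t)\<close>, which tends to \<open>0\<close> at the origin and
  to \<open>- 1\<close> at infinity because \<open>ln_cosh (a t) - a t\<close> is bounded.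
\<close>
lemma ln_cosh_minus_tanh_integral:
  assumes a: "Re a > 0"
  shows "half_line_integral (\<lambda>t. ln_cosh (a * of_real t) / (a * of_real (t\<^sup>2))
            - tanh (a * of_real t) / of_real t) (- 1)"
proof -
  have a0: "a \<noteq> 0" using a by auto
  obtain C where C: "C > 0"
    "\<And>t. t \<ge> 0 \<Longrightarrow> norm (tanh (a * of_real t)) \<le> C * t"
    "\<And>t. t \<ge> 0 \<Longrightarrow> norm (1 - tanh (a * of_real t)) \<le> C / (1 + t\<^sup>2)"
    "\<And>t. t \<ge> 0 \<Longrightarrow> norm (ln_cosh (a * of_real t)) \<le> C * t\<^sup>2"
    "\<And>t. t \<ge> 0 \<Longrightarrow> norm (ln_cosh (a * of_real t) - a * of_real t) \<le> C"
    using tanh_ln_cosh_bounds[OF a] by metis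
  let ?f = "\<lambda>t. ln_cosh (a * of_real t) / (a * of_real (t\<^sup>2)) - tanh (a * of_real t) / of_real t"
  let ?F = "\<lambda>t. - (ln_cosh (a * of_real t) / (a * of_real t))"
  define K where "K = C / norm a + C"
  have K: "K > 0" using C(1) a0 by (simp add: K_def add_pos_pos)
  have b1: "norm (?f t) \<le> K" if t: "t > 0" for t
  proof -
    have "norm (ln_cosh (a * of_real t) / (a * of_real (t\<^sup>2))) \<le> C / norm a"
      using C(4)[of t] t a0 by (simp add: norm_divide norm_mult divide_simps norm_power mult_ac)
    moreover have "norm (tanh (a * of_real t) / of_real t) \<le> C"
      using C(2)[of t] t by (simp add: norm_divide divide_simps)
    ultimately show ?thesis unfolding K_def by (intro norm_triangle_le_diff add_mono)
  qed
  have b2: "norm (?f t) \<le> K / t\<^sup>2" if t: "t > 0" for t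
  proof -
    have "?f t = (ln_cosh (a * of_real t) - a * of_real t) / (a * of_real (t\<^sup>2))
        + (1 - tanh (a * of_real t)) / of_real t"
      using t a0 by (simp add: field_simps power2_eq_square)
    also have "norm \<dots> \<le> C / norm a / t\<^sup>2 + C / t\<^sup>2"
    proof (rule norm_triangle_le[OF add_mono])
      show "norm ((ln_cosh (a * of_real t) - a * of_real t) / (a * of_real (t\<^sup>2))) \<le> C / norm a / t\<^sup>2"
        using C(5)[of t] t a0 by (simp add: norm_divide norm_mult divide_right_mono norm_power)
      have "norm ((1 - tanh (a * of_real t)) / of_real t) \<le> C / (1 + t\<^sup>2) / t"
        using C(3)[of t] t divide_right_mono[OF C(3), of t t] by (simp add: norm_divide)
      also have "\<dots> \<le> C / t\<^sup>2"
      proof -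
        have "t \<le> 1 + t\<^sup>2" using zero_le_power2[of "t - 1"] t by (simp add: power2_diff)
        hence "t * t \<le> (1 + t\<^sup>2) * t" using t by (intro mult_right_mono) auto
        moreover have "1 + t\<^sup>2 > 0" by (simp add: add_pos_nonneg)
        ultimately show ?thesis unfolding divide_divide_eq_left power2_eq_square[of t]
          using t C(1) by (intro divide_left_mono) (auto simp: power2_eq_square)
      qed
      finally show "norm ((1 - tanh (a * of_real t)) / of_real t) \<le> C / t\<^sup>2" .
    qed
    also have "\<dots> = K / t\<^sup>2" by (simp add: K_def add_divide_distrib)
    finally show ?thesis .
  qed
  have bnd: "norm (?f t) \<le> 2 * K * (1 / (t\<^sup>2 + 1\<^sup>2))" if t: "t > 0" for t
  proof -
    have "norm (?f t) * t\<^sup>2 \<le> K" using b2[OF t] t by (simp add: field_simps)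
    hence "norm (?f t) * (t\<^sup>2 + 1\<^sup>2) \<le> 2 * K" using b1[OF t] by (simp add: ring_distribs)
    moreover have "t\<^sup>2 + 1\<^sup>2 > 0" by (simp add: add_nonneg_pos)
    ultimately show ?thesis by (simp only: pos_le_divide_eq mult_1_right times_divide_eq_right)
  qed
  have cont: "continuous_on {0<..} ?f"
    using a0 by (intro continuous_intros continuous_on_subset[OF continuous_on_tanh_ln_cosh_ray(1)[OF a]]
       continuous_on_subset[OF continuous_on_tanh_ln_cosh_ray(2)[OF a]]) auto
  have D: "(?F has_vector_derivative ?f t) (at t)" if t: "t > 0" for t
  proof -
    have *: "Re (a * of_real t) > 0 \<or> a * of_real t = 0" using a t by simp
    have "((\<lambda>z. ln_cosh (a * z)) has_field_derivative tanh (a * of_real t) * a) (at (of_real t))"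
      by (rule DERIV_chain2[where f = ln_cosh and g = "\<lambda>z. a * z", OF ln_cosh_derivative[OF *]])
         (auto intro!: derivative_eq_intros)
    hence "((\<lambda>z. - (ln_cosh (a * z) / (a * z))) has_field_derivative
        - ((tanh (a * of_real t) * a * (a * of_real t) - ln_cosh (a * of_real t) * a)
           / ((a * of_real t) * (a * of_real t)))) (at (of_real t))"
      using t a0 by (auto intro!: derivative_eq_intros)
    also have "- ((tanh (a * of_real t) * a * (a * of_real t) - ln_cosh (a * of_real t) * a)
           / ((a * of_real t) * (a * of_real t))) = ?f t"
      using t a0 by (simp add: field_simps power2_eq_square)
    finally show ?thesis by (rule has_vector_derivative_real_field)
  qed
  have A: "(?F \<longlongrightarrow> 0) (at_right 0)"
  proof (rule Lim_null_comparison)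
    show "\<forall>\<^sub>F t in at_right 0. norm (?F t) \<le> C / norm a * t"
      using eventually_at_right_less
    proof eventually_elim
      case (elim t)
      thus ?case using C(4)[of t] a0
        by (simp add: norm_divide norm_mult divide_simps power2_eq_square mult_ac)
    qed
    show "((\<lambda>t. C / norm a * t) \<longlongrightarrow> 0) (at_right 0)"
      by (intro tendsto_mult_right_zero tendsto_ident_at)
  qed
  have "((\<lambda>t. ?F t - (-1)) \<longlongrightarrow> 0) at_top"
  proof (rule Lim_null_comparison)
    show "\<forall>\<^sub>F t in at_top. norm (?F t - (-1)) \<le> C / norm a * (1 / t)"
      using eventually_gt_at_top[of 0]
    proof eventually_elim
      case (elim t)
      have "?F t - (-1) = - ((ln_cosh (a * of_real t) - a * of_real t) / (a * of_real t))"
        using elim a0 by (simp add: field_simps)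
      thus ?case using C(5)[of t] a0 elim
        by (simp only: norm_minus_cancel norm_divide norm_mult norm_of_real) (simp add: divide_simps)
    qed
    have "((\<lambda>t. C / norm a * (1 / t)) \<longlongrightarrow> C / norm a * 0) at_top"
      by (intro tendsto_intros tendsto_divide_0[OF tendsto_const] filterlim_at_top_imp_at_infinity filterlim_ident)
    thus "((\<lambda>t. C / norm a * (1 / t)) \<longlongrightarrow> 0) at_top" by simp
  qed
  hence B: "(?F \<longlongrightarrow> -1) at_top" by (simp only: LIM_zero_iff)
  have "set_integrable lborel {0<..} (\<lambda>t::real. 2 * K * (1 / (t\<^sup>2 + 1\<^sup>2)))"
    by (intro set_integrable_mult_right inverse_sum_squares_integral(1)) simp
  from half_line_integral_FTC[OF D cont half_line_integrable_bound[OF cont this bnd] A B]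
  have "half_line_integral ?f (-1 - 0)" by blast
  thus ?thesis by simp
qed

lemma arctan_bounds:
  assumes "y > 0" "t > 0"
  shows "0 \<le> 1 / t - 1 / y * arctan (y / t)" "1 / t - 1 / y * arctan (y / t) \<le> 1 / t"
proof -
  have "arctan (y / t) \<le> y / t" using assms by (intro arctan_le_self) auto
  hence "1 / y * arctan (y / t) \<le> 1 / y * (y / t)" using assms by (intro mult_left_mono) auto
  thus "0 \<le> 1 / t - 1 / y * arctan (y / t)" using assms by simp
  have "arctan (y / t) \<ge> 0" using assms by simp
  thus "1 / t - 1 / y * arctan (y / t) \<le> 1 / t" using assms by simp
qed

text \<open>
  Integration by parts: the derivative of \<open>1 / t - arctan (y / t) / y\<close> is \<open>- y\<^sup>2 / (t\<^sup>2 (t\<^sup>2 + y\<^sup>2))\<close>, and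
  that of \<open>ln_cosh (a t) / a\<close> is \<open>tanh (a t)\<close>. The boundary terms vanish: \<open>ln_cosh (a t)\<close> is
  quadratic at the origin and grows linearly, while \<open>1 - t * arctan (y / t) / y\<close> tends to \<open>0\<close>.
\<close>
lemma ln_cosh_kernel_integral:
  assumes a: "Re a > 0" and y: "y > 0"
    and I: "half_line_integral (\<lambda>t. tanh (a * of_real t) * of_real (1 / t - 1 / y * arctan (y / t))) I"
  shows "half_line_integral (\<lambda>t. ln_cosh (a * of_real t) / of_real (t\<^sup>2 * (t\<^sup>2 + y\<^sup>2)))
           (a / of_real (y\<^sup>2) * I)"
proof -
  have a0: "a \<noteq> 0" using a by auto
  have pos: "t\<^sup>2 + y\<^sup>2 > 0" for t using y by (simp add: add_nonneg_pos)
  have nz: "t\<^sup>2 + y\<^sup>2 \<noteq> 0" for t using pos[of t] by linarith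
  obtain C where C: "C > 0"
    "\<And>t. t \<ge> 0 \<Longrightarrow> norm (ln_cosh (a * of_real t)) \<le> C * t\<^sup>2"
    "\<And>t. t \<ge> 0 \<Longrightarrow> norm (ln_cosh (a * of_real t) - a * of_real t) \<le> C"
    using tanh_ln_cosh_bounds[OF a] by metis
  let ?A = "\<lambda>t. 1 / t - 1 / y * arctan (y / t)"
  let ?g = "\<lambda>t. tanh (a * of_real t) * of_real (?A t)"
  let ?h = "\<lambda>t. ln_cosh (a * of_real t) / of_real (t\<^sup>2 * (t\<^sup>2 + y\<^sup>2))"
  let ?k = "of_real (y\<^sup>2) / a"
  let ?F = "\<lambda>t. ln_cosh (a * of_real t) / a * of_real (?A t)"
  have ch: "continuous_on {0<..} ?h"
    using square_add_nonzero[of "of_real y"] y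
    by (intro continuous_intros continuous_on_subset[OF continuous_on_tanh_ln_cosh_ray(2)[OF a]]) auto
  have cg: "continuous_on {0<..} ?g"
    using y by (intro continuous_intros continuous_on_subset[OF continuous_on_tanh_ln_cosh_ray(1)[OF a]]) auto
  have ih: "set_integrable lborel {0<..} ?h"
  proof (rule half_line_integrable_bound[OF ch])
    show "set_integrable lborel {0<..} (\<lambda>t. C * (1 / (t\<^sup>2 + y\<^sup>2)))"
      by (intro set_integrable_mult_right inverse_sum_squares_integral(1) y)
    show "norm (?h t) \<le> C * (1 / (t\<^sup>2 + y\<^sup>2))" if t: "t > 0" for t
    proof -
      have "norm (?h t) = norm (ln_cosh (a * of_real t)) / (t\<^sup>2 * (t\<^sup>2 + y\<^sup>2))"
        unfolding norm_divide norm_of_real using pos[of t] by (simp add: abs_mult)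
      also have "\<dots> \<le> C * t\<^sup>2 / (t\<^sup>2 * (t\<^sup>2 + y\<^sup>2))"
        using C(2)[of t] t pos[of t] by (intro divide_right_mono) auto
      finally show ?thesis using t by simp
    qed
  qed
  have ig: "set_integrable lborel {0<..} ?g" using I by (simp add: half_line_integral_iff)
  have D: "(?F has_vector_derivative ?g t - ?k * ?h t) (at t)" if t: "t > 0" for t
  proof -
    have e: "1 + (y / t)\<^sup>2 = (t\<^sup>2 + y\<^sup>2) / t\<^sup>2" using t by (simp add: field_simps)
    have "(?A has_real_derivative - (1 / t\<^sup>2) - 1 / y * (- (y / t\<^sup>2) / (1 + (y / t)\<^sup>2))) (at t)"
      using t by (auto intro!: derivative_eq_intros simp: power2_eq_square divide_inverse)
    also have "- (1 / t\<^sup>2) - 1 / y * (- (y / t\<^sup>2) / (1 + (y / t)\<^sup>2)) = - (y\<^sup>2 / (t\<^sup>2 * (t\<^sup>2 + y\<^sup>2)))"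
      unfolding e using t y nz[of t] by (simp add: divide_simps) 
    finally have "((\<lambda>t. complex_of_real (?A t)) has_vector_derivative
        of_real (- (y\<^sup>2 / (t\<^sup>2 * (t\<^sup>2 + y\<^sup>2))))) (at t)"
      by (intro has_vector_derivative_of_real) (simp add: has_real_derivative_iff_has_vector_derivative)
    moreover have "((\<lambda>t. ln_cosh (a * of_real t) / a) has_vector_derivative a * tanh (a * of_real t) / a) (at t)"
      using t by (intro has_vector_derivative_divide ln_cosh_tanh_ray_derivative a) auto
    ultimately have "(?F has_vector_derivative
        ln_cosh (a * of_real t) / a * of_real (- (y\<^sup>2 / (t\<^sup>2 * (t\<^sup>2 + y\<^sup>2)))) +
        a * tanh (a * of_real t) / a * of_real (?A t)) (at t)"
      by (rule has_vector_derivative_mult[rotated])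
    thus ?thesis
    proof (rule has_vector_derivative_eq_rhs)
      have "of_real (- (y\<^sup>2 / (t\<^sup>2 * (t\<^sup>2 + y\<^sup>2)))) = - (of_real (y\<^sup>2) / complex_of_real (t\<^sup>2 * (t\<^sup>2 + y\<^sup>2)))"
        by (simp only: of_real_minus of_real_divide)
      thus "ln_cosh (a * of_real t) / a * of_real (- (y\<^sup>2 / (t\<^sup>2 * (t\<^sup>2 + y\<^sup>2)))) +
        a * tanh (a * of_real t) / a * of_real (?A t) = ?g t - ?k * ?h t"
        using a0 by simp
    qed
  qed
  have A: "(?F \<longlongrightarrow> 0) (at_right 0)"
  proof (rule Lim_null_comparison)
    show "\<forall>\<^sub>F t in at_right 0. norm (?F t) \<le> C / norm a * t"
      using eventually_at_right_less
    proof eventually_elim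
      case (elim t)
      have "norm (?F t) = norm (ln_cosh (a * of_real t)) / norm a * ?A t"
        unfolding norm_mult norm_divide norm_of_real using arctan_bounds(1)[OF y, of t] elim by simp
      also have "\<dots> \<le> (C * t\<^sup>2) / norm a * (1 / t)"
        using C(1,2) arctan_bounds[OF y, of t] elim
        by (intro mult_mono divide_right_mono) auto
      finally show ?case using elim by (simp add: power2_eq_square)
    qed
    show "((\<lambda>t. C / norm a * t) \<longlongrightarrow> 0) (at_right 0)"
      by (intro tendsto_mult_right_zero tendsto_ident_at)
  qed
  have B: "(?F \<longlongrightarrow> 0) at_top"
  proof (rule Lim_null_comparison)
    show "\<forall>\<^sub>F t in at_top. norm (?F t) \<le> C / norm a * ?A t + t * ?A t"
      using eventually_gt_at_top[of 0]
    proof eventually_elim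
      case (elim t)
      have "norm (ln_cosh (a * of_real t)) \<le> C + norm a * t"
        using norm_triangle_ineq[of "ln_cosh (a * of_real t) - a * of_real t" "a * of_real t"] C(3)[of t] elim
        by (simp add: norm_mult)
      hence "norm (ln_cosh (a * of_real t)) / norm a \<le> (C + norm a * t) / norm a"
        by (intro divide_right_mono) auto
      also have "\<dots> = C / norm a + t" using a0 by (simp add: add_divide_distrib)
      finally have "norm (ln_cosh (a * of_real t)) / norm a * ?A t \<le> (C / norm a + t) * ?A t"
        using arctan_bounds(1)[OF y elim] by (rule mult_right_mono)
      moreover have "norm (?F t) = norm (ln_cosh (a * of_real t)) / norm a * ?A t"
        unfolding norm_mult norm_divide norm_of_real using arctan_bounds(1)[OF y elim] by simp
      ultimately show ?case by (simp only: distrib_right)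
    qed
    have "(?A \<longlongrightarrow> 0) at_top" "((\<lambda>t. t * ?A t) \<longlongrightarrow> 0) at_top"
      using y by real_asymp+
    thus "((\<lambda>t. C / norm a * ?A t + t * ?A t) \<longlongrightarrow> 0) at_top"
      by (intro tendsto_add_zero tendsto_mult_right_zero)
  qed
  have "continuous_on {0<..} (\<lambda>t. ?g t - ?k * ?h t)"
    by (intro continuous_on_diff continuous_on_mult continuous_on_const cg ch)
  moreover have "set_integrable lborel {0<..} (\<lambda>t. ?g t - ?k * ?h t)"
    by (intro set_integral_diff(1) ig set_integrable_mult_right ih)
  ultimately have "half_line_integral (\<lambda>t. ?g t - ?k * ?h t) (0 - 0)"
    by (intro half_line_integral_FTC[OF D _ _ A B])
  from half_line_integral_cmult[OF half_line_integral_diff[OF I this], of "1 / ?k"]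
  show ?thesis
  proof (rule half_line_integral_cong)
    have "1 / k * (g - (g - k * h)) = h" if "k \<noteq> 0" for k g h :: complex using that by simp
    moreover have "?k \<noteq> 0" using a0 y by simp
    ultimately show "1 / ?k * (?g t - (?g t - ?k * ?h t)) = ?h t" for t by blast
  qed simp
qed

section \<open>Integrating the digamma function\<close>

text \<open>
  The antiderivative in \<open>s\<close> is \<open>ln_Gamma (1/2 + x s) / x - Digamma (1/2) * s\<close>.
\<close>
lemma Digamma_half_integral:
  fixes x :: complex
  assumes x: "Re x > 0"
  shows "has_bochner_integral lborel
     (\<lambda>s. indicator {0..1} s *\<^sub>R (Digamma (1/2 + x * of_real s) - Digamma (1/2)))
     ((ln_Gamma (1/2 + x) - ln_Gamma (1/2)) / x - Digamma (1/2))"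
proof -
  have x0: "x \<noteq> 0" using x by auto
  have re: "Re (1/2 + x * of_real s) > 0" if "s \<ge> 0" for s
    using x that by (simp add: add_pos_nonneg)
  have np: "1/2 + x * of_real s \<notin> \<real>\<^sub>\<le>\<^sub>0" if "s \<ge> 0" for s
    using re[OF that] by (auto simp: complex_nonpos_Reals_iff)
  have np_int: "1/2 + x * of_real s \<notin> \<int>\<^sub>\<le>\<^sub>0" if "s \<ge> 0" for s
    using np[OF that] nonpos_Ints_subset_nonpos_Reals by blast
  let ?F = "\<lambda>s. ln_Gamma (1/2 + x * of_real s) / x - Digamma (1/2) * of_real s"
  have "has_bochner_integral lborel
     (\<lambda>s. indicator {0..1} s *\<^sub>R (Digamma (1/2 + x * of_real s) - Digamma (1/2))) (?F 1 - ?F 0)"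
  proof (rule has_bochner_integral_FTC_Icc)
    fix s :: real assume s: "0 \<le> s"
    have "((\<lambda>z. ln_Gamma (1/2 + x * z) / x - Digamma (1/2) * z) has_field_derivative
        Digamma (1/2 + x * of_real s) - Digamma (1/2)) (at (of_real s))"
      using np[OF s] x0 by (auto intro!: derivative_eq_intros)
    thus "(?F has_vector_derivative Digamma (1/2 + x * of_real s) - Digamma (1/2)) (at s within {0..1})"
      by (rule has_vector_derivative_real_field)
  next
    show "continuous_on {0..1} (\<lambda>s. Digamma (1/2 + x * of_real s) - Digamma (1/2))"
      using np_int by (intro continuous_intros continuous_on_compose2[OF continuous_on_Polygamma[where A = "- \<int>\<^sub>\<le>\<^sub>0"]]) auto
  qed auto
  moreover have "?F 1 - ?F 0 = (ln_Gamma (1/2 + x) - ln_Gamma (1/2)) / x - Digamma (1/2)"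
    by (simp add: diff_divide_distrib)
  ultimately show ?thesis by (simp only:)
qed

text \<open>
  The antiderivative in \<open>s\<close> is \<open>s / t - arctan (s y / t) / y\<close>.
\<close>
lemma rational_kernel_integral_01:
  assumes t: "t > 0" and y: "y > 0"
  shows "has_bochner_integral lborel
     (\<lambda>s. indicator {0..1} s *\<^sub>R ((s * y)\<^sup>2 / (t * (t\<^sup>2 + (s * y)\<^sup>2))))
     (1 / t - 1 / y * arctan (y / t))"
proof -
  have pos: "t\<^sup>2 + (s * y)\<^sup>2 > 0" for s using t by (simp add: add_pos_nonneg)
  have nz: "t\<^sup>2 + (s * y)\<^sup>2 \<noteq> 0" for s using pos[of s] by linarith
  let ?F = "\<lambda>s. s / t - 1 / y * arctan (s * y / t)"
  have "has_bochner_integral lborel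
     (\<lambda>s. indicator {0..1} s *\<^sub>R ((s * y)\<^sup>2 / (t * (t\<^sup>2 + (s * y)\<^sup>2)))) (?F 1 - ?F 0)"
  proof (rule has_bochner_integral_FTC_Icc)
    fix s :: real
    have e: "1 + (s * y / t)\<^sup>2 = (t\<^sup>2 + (s * y)\<^sup>2) / t\<^sup>2" using t by (simp add: field_simps)
    have "(?F has_real_derivative 1 / t - 1 / y * (y / t / (1 + (s * y / t)\<^sup>2))) (at s within {0..1})"
      using t by (auto intro!: derivative_eq_intros simp: divide_inverse)
    also have "1 / t - 1 / y * (y / t / (1 + (s * y / t)\<^sup>2)) = (s * y)\<^sup>2 / (t * (t\<^sup>2 + (s * y)\<^sup>2))"
    proof -
      have "1 / t - 1 / y * (y / t / (q / t\<^sup>2)) = (q - t\<^sup>2) / (t * q)" if "q \<noteq> 0" for q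
        using that t y by (simp add: divide_simps power2_eq_square)
      from this[OF nz[of s]] show ?thesis unfolding e by simp
    qed
    finally show "(?F has_vector_derivative (s * y)\<^sup>2 / (t * (t\<^sup>2 + (s * y)\<^sup>2))) (at s within {0..1})"
      by (simp add: has_real_derivative_iff_has_vector_derivative)
  next
    show "continuous_on {0..1} (\<lambda>s. (s * y)\<^sup>2 / (t * (t\<^sup>2 + (s * y)\<^sup>2)))"
      using t nz by (intro continuous_intros) auto
  qed auto
  thus ?thesis by simp
qed

text \<open>
  The double integral of \<open>tanh (a t) * (s y)\<^sup>2 / (t (t\<^sup>2 + (s y)\<^sup>2))\<close> over \<open>s\<close> in \<open>[0, 1]\<close> and \<open>t > 0\<close>,
  evaluated in both orders.
\<close>
lemma tanh_arctan_integral: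
  assumes a: "Re a > 0" and y: "y > 0"
  defines "x \<equiv> a * of_real y / of_real pi"
  shows "half_line_integral (\<lambda>t. tanh (a * of_real t) * of_real (1 / t - 1 / y * arctan (y / t)))
           ((ln_Gamma (1/2 + x) - ln_Gamma (1/2)) / x - Digamma (1/2))"
proof -
  obtain C where C: "C > 0" "\<And>t. t \<ge> 0 \<Longrightarrow> norm (tanh (a * of_real t)) \<le> C * t"
    using tanh_ln_cosh_bounds[OF a] by metis
  have x: "Re x > 0" using a y by (simp add: x_def)
  define T where "T = (\<lambda>t. indicator {0<..} t *\<^sub>R tanh (a * of_real t))"
  define f where "f = (\<lambda>s t. indicator {0..1} s *\<^sub>R (T t * of_real ((s * y)\<^sup>2 / (t * (t\<^sup>2 + (s * y)\<^sup>2)))))"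
  have "continuous_on {0<..} (\<lambda>t. tanh (a * of_real t))"
    by (rule continuous_on_subset[OF continuous_on_tanh_ln_cosh_ray(1)[OF a]]) auto
  hence T[measurable]: "T \<in> borel_measurable borel" unfolding T_def
    by (intro borel_measurable_continuous_on_indicator) auto
  define u :: "real \<Rightarrow> real" where "u = indicator {0..1}"
  define v :: "real \<Rightarrow> real" where "v = (\<lambda>t. indicator {0<..} t *\<^sub>R (C * y\<^sup>2 * (1 / (t\<^sup>2 + y\<^sup>2))))"
  have u: "integrable lborel u" unfolding u_def by simp
  have v: "integrable lborel v" unfolding v_def set_integrable_def[symmetric]
    by (intro set_integrable_mult_right inverse_sum_squares_integral(1) y)
  have [measurable]: "v \<in> borel_measurable borel" "u \<in> borel_measurable borel"
    using borel_measurable_integrable[OF v] borel_measurable_integrable[OF u] by simp_all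
  have uv: "integrable (lborel \<Otimes>\<^sub>M lborel) (\<lambda>(s, t). u s * v t)"
    by (rule lborel_pair.Fubini_integrable) (use u v in \<open>auto simp: abs_mult\<close>)
  \<comment> \<open>The bound \<open>C * t\<close> for \<open>tanh (a t)\<close> cancels the pole at \<open>t = 0\<close>; the quotient that remains increases with \<open>s\<close>.\<close>
  have f_bound: "norm (f s t) \<le> u s * v t" for s t
  proof (cases "0 \<le> s \<and> s \<le> 1 \<and> t > 0")
    case True
    hence s: "0 \<le> s" "s \<le> 1" and t: "t > 0" by auto
    have pos: "t\<^sup>2 + (s * y)\<^sup>2 > 0" "t\<^sup>2 + y\<^sup>2 > 0" using t by (auto simp: add_pos_nonneg)
    have sy: "(s * y)\<^sup>2 \<le> y\<^sup>2" using s y by (intro power_mono mult_left_le_one_le) auto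
    have "norm (f s t) = norm (tanh (a * of_real t)) * ((s * y)\<^sup>2 / (t * (t\<^sup>2 + (s * y)\<^sup>2)))"
      using True pos unfolding f_def T_def norm_scaleR norm_mult norm_of_real by simp
    also have "\<dots> \<le> (C * t) * ((s * y)\<^sup>2 / (t * (t\<^sup>2 + (s * y)\<^sup>2)))"
      using C(2)[of t] t pos by (intro mult_right_mono) auto
    also have "\<dots> = C * ((s * y)\<^sup>2 / (t\<^sup>2 + (s * y)\<^sup>2))" using t by simp
    also have "\<dots> \<le> C * (y\<^sup>2 / (t\<^sup>2 + y\<^sup>2))"
    proof (intro mult_left_mono)
      have "(s * y)\<^sup>2 * t\<^sup>2 \<le> y\<^sup>2 * t\<^sup>2" using sy by (rule mult_right_mono) simp
      hence "(s * y)\<^sup>2 * (t\<^sup>2 + y\<^sup>2) \<le> y\<^sup>2 * (t\<^sup>2 + (s * y)\<^sup>2)"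
        by (simp only: distrib_left mult.commute[of "y\<^sup>2" "(s * y)\<^sup>2"])
      thus "(s * y)\<^sup>2 / (t\<^sup>2 + (s * y)\<^sup>2) \<le> y\<^sup>2 / (t\<^sup>2 + y\<^sup>2)"
        using pos by (simp add: divide_simps)
    qed (use C in simp)
    finally show ?thesis using True by (simp add: u_def v_def)
  next
    case False
    have "0 \<le> u s * v t" using C(1) by (simp add: u_def v_def)
    thus ?thesis using False by (auto simp: f_def T_def indicator_def)
  qed
  have int: "integrable (lborel \<Otimes>\<^sub>M lborel) (\<lambda>(s, t). f s t)"
  proof (rule Bochner_Integration.integrable_bound[OF uv])
    show "(\<lambda>(s, t). f s t) \<in> borel_measurable (lborel \<Otimes>\<^sub>M lborel)"
      unfolding f_def by measurable
    show "AE z in lborel \<Otimes>\<^sub>M lborel. norm (case z of (s, t) \<Rightarrow> f s t) \<le> norm (case z of (s, t) \<Rightarrow> u s * v t)"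
      using f_bound by (intro AE_I2) (auto split: prod.splits intro!: order_trans[OF f_bound abs_ge_self])
  qed
  have s_int: "(LINT s|lborel. f s t) = indicator {0<..} t *\<^sub>R
        (tanh (a * of_real t) * of_real (1 / t - 1 / y * arctan (y / t)))" for t
  proof (cases "t > 0")
    case True
    have "has_bochner_integral lborel
       (\<lambda>s. T t * of_real (indicator {0..1} s *\<^sub>R ((s * y)\<^sup>2 / (t * (t\<^sup>2 + (s * y)\<^sup>2)))))
       (T t * of_real (1 / t - 1 / y * arctan (y / t)))"
      by (intro has_bochner_integral_mult_right has_bochner_integral_of_real
           rational_kernel_integral_01 True y)
    also have "(\<lambda>s. T t * of_real (indicator {0..1} s *\<^sub>R ((s * y)\<^sup>2 / (t * (t\<^sup>2 + (s * y)\<^sup>2))))) = (\<lambda>s. f s t)"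
      by (auto simp: f_def fun_eq_iff indicator_def)
    finally show ?thesis using True by (simp add: has_bochner_integral_iff T_def)
  qed (simp add: f_def T_def)
  have t_int: "(LINT t|lborel. f s t) = indicator {0..1} s *\<^sub>R (Digamma (1/2 + x * of_real s) - Digamma (1/2))" for s
  proof (cases "0 < s \<and> s \<le> 1")
    case True
    have sy: "s * y > 0" using True y by simp
    have "f s = (\<lambda>t. indicator {0<..} t *\<^sub>R (tanh (a * of_real t) * of_real ((s * y)\<^sup>2 / (t * (t\<^sup>2 + (s * y)\<^sup>2)))))"
      using True by (auto simp: f_def T_def fun_eq_iff indicator_def)
    with tanh_kernel_integral[OF a sy]
    have "(LINT t|lborel. f s t) = Digamma (1/2 + a * of_real (s * y) / of_real pi) - Digamma (1/2)"
      by (simp add: half_line_integral_def has_bochner_integral_iff)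
    moreover have "a * of_real (s * y) / of_real pi = x * of_real s" by (simp add: x_def)
    ultimately show ?thesis using True by simp
  next
    case False
    hence "s = 0 \<or> s \<notin> {0..1}" by auto
    thus ?thesis by (auto simp: f_def)
  qed
  have "integrable lborel (\<lambda>t. LINT s|lborel. f s t)"
    by (rule lborel_pair.integrable_snd[OF int])
  moreover have "(LINT t|lborel. LINT s|lborel. f s t) = (LINT s|lborel. LINT t|lborel. f s t)"
    by (rule lborel_pair.Fubini_integral[OF int])
  moreover have "(LINT s|lborel. LINT t|lborel. f s t) = (ln_Gamma (1/2 + x) - ln_Gamma (1/2)) / x - Digamma (1/2)"
    using Digamma_half_integral[OF x] unfolding t_int by (simp add: has_bochner_integral_iff)
  ultimately show ?thesis unfolding s_int half_line_integral_def has_bochner_integral_iff by simp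
qed

section \<open>Branches on the half-plane and the five formulas\<close>

lemma halfplane_ln_cosh:
  assumes t: "t > 0" and a: "Re a > 0"
  shows "halfplane_ln (\<lambda>z. cosh (z * of_real t)) a = ln_cosh (a * of_real t)"
proof (rule halfplane_ln_eq)
  have re: "Re (z * of_real t) > 0" if "Re z > 0" for z using that t by simp
  show "is_ln_branch (\<lambda>z. ln_cosh (z * of_real t)) (\<lambda>z. cosh (z * of_real t))"
    unfolding is_ln_branch_def
  proof (intro conjI ballI allI impI)
    have "((\<lambda>z. ln_cosh (z * of_real t)) has_field_derivative tanh (z * of_real t) * of_real t) (at z)"
      if "Re z > 0" for z
      by (rule DERIV_chain2[where f = ln_cosh and g = "\<lambda>z. z * of_real t", OF ln_cosh_derivative])
         (use re[OF that] in \<open>auto intro!: derivative_eq_intros\<close>)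
    thus "(\<lambda>z. ln_cosh (z * of_real t)) holomorphic_on right_halfplane"
      by (auto simp: holomorphic_on_def field_differentiable_def right_halfplane_def
           intro: has_field_derivative_at_within)
    show "exp (ln_cosh (z * of_real t)) = cosh (z * of_real t)" if "z \<in> right_halfplane" for z
      using that by (intro exp_ln_cosh re) (simp add: right_halfplane_def)
    fix x :: real assume "x > 0"
    have "ln_cosh (of_real x * of_real t) = of_real (x * t + ln (1 + exp (- 2 * (x * t))) - ln 2)"
    proof -
      have "1 + exp (- 2 * (of_real x * of_real t)) = complex_of_real (1 + exp (- 2 * (x * t)))"
        by (simp add: exp_of_real[symmetric])
      moreover have "1 + exp (- 2 * (x * t)) > 0" by (simp add: add_pos_pos)
      ultimately show ?thesis unfolding ln_cosh_def by (simp only: Ln_of_real) simp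
    qed
    thus "ln_cosh (of_real x * of_real t) \<in> \<real>" by (simp only: Reals_of_real)
  qed
qed (use a in \<open>simp add: right_halfplane_def\<close>)

lemma halfplane_ln_four_mult:
  assumes r: "r > 0" and a: "Re a > 0"
  shows "halfplane_ln (\<lambda>z. 4 * z * of_real r / of_real pi) a = Ln (4 * a * of_real r / of_real pi)"
proof (rule halfplane_ln_eq)
  have re: "Re (4 * z * of_real r / of_real pi) > 0" if "Re z > 0" for z using that r by simp
  hence np: "4 * z * of_real r / of_real pi \<notin> \<real>\<^sub>\<le>\<^sub>0" if "Re z > 0" for z
    using re[OF that] by (auto simp: complex_nonpos_Reals_iff)
  show "is_ln_branch (\<lambda>z. Ln (4 * z * of_real r / of_real pi)) (\<lambda>z. 4 * z * of_real r / of_real pi)"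
    unfolding is_ln_branch_def
  proof (intro conjI ballI allI impI)
    show "(\<lambda>z. Ln (4 * z * of_real r / of_real pi)) holomorphic_on right_halfplane"
      using np by (intro holomorphic_intros) (auto simp: right_halfplane_def)
    show "exp (Ln (4 * z * of_real r / of_real pi)) = 4 * z * of_real r / of_real pi"
      if "z \<in> right_halfplane" for z
    proof (rule exp_Ln)
      show "4 * z * of_real r / of_real pi \<noteq> 0"
        using that r by (auto simp: right_halfplane_def)
    qed
    fix x :: real assume x: "x > 0"
    have "4 * of_real x * of_real r / of_real pi = complex_of_real (4 * x * r / pi)" by simp
    moreover have "4 * x * r / pi > 0" using x r by simp
    ultimately show "Ln (4 * of_real x * of_real r / of_real pi) \<in> \<real>"
      by (simp only: Ln_of_real Reals_of_real)
  qed
qed (use a in \<open>simp add: right_halfplane_def\<close>)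

text \<open>
  The value \<open>Gamma (1/2) = sqrt pi\<close> makes \<open>ln_Gamma (1/2)\<close> the logarithm of the denominator.
\<close>
lemma halfplane_ln_Gamma:
  assumes r: "r > 0" and a: "Re a > 0"
  shows "halfplane_ln (\<lambda>z. Gamma (1/2 + z * of_real r / of_real pi) / of_real (sqrt pi)) a =
           ln_Gamma (1/2 + a * of_real r / of_real pi) - ln_Gamma (1/2)"
proof (rule halfplane_ln_eq)
  let ?p = "\<lambda>z. 1/2 + z * of_real r / of_real pi :: complex"
  have re: "Re (?p z) > 0" if "Re z > 0" for z using that r by (simp add: add_pos_pos)
  hence np: "?p z \<notin> \<real>\<^sub>\<le>\<^sub>0" if "Re z > 0" for z
    using re[OF that] by (auto simp: complex_nonpos_Reals_iff)
  have np_int: "?p z \<notin> \<int>\<^sub>\<le>\<^sub>0" if "Re z > 0" for z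
    using np[OF that] nonpos_Ints_subset_nonpos_Reals by blast
  have half: "ln_Gamma (1/2 :: complex) = of_real (ln_Gamma (1/2))"
    using ln_Gamma_complex_of_real[of "1/2"] by simp
  have exp_half: "exp (ln_Gamma (1/2 :: complex)) = of_real (sqrt pi)"
  proof -
    have "1/2 \<notin> (\<real>\<^sub>\<le>\<^sub>0 :: complex set)" by (auto simp: complex_nonpos_Reals_iff)
    hence "1/2 \<notin> (\<int>\<^sub>\<le>\<^sub>0 :: complex set)" using nonpos_Ints_subset_nonpos_Reals by blast
    hence "Gamma (1/2 :: complex) = exp (ln_Gamma (1/2))" by (simp add: Gamma_complex_altdef)
    thus ?thesis by (simp add: Gamma_one_half_complex)
  qed
  show "is_ln_branch (\<lambda>z. ln_Gamma (?p z) - ln_Gamma (1/2)) (\<lambda>z. Gamma (?p z) / of_real (sqrt pi))"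
    unfolding is_ln_branch_def
  proof (intro conjI ballI allI impI)
    have "ln_Gamma holomorphic_on {z. Re z > 0}"
      by (rule holomorphic_ln_Gamma) (auto simp: complex_nonpos_Reals_iff)
    hence "(\<lambda>z. ln_Gamma (?p z)) holomorphic_on right_halfplane"
      by (rule holomorphic_on_compose_gen[of ?p _ ln_Gamma, unfolded o_def, rotated])
         (use re in \<open>auto intro!: holomorphic_intros simp: right_halfplane_def\<close>)
    thus "(\<lambda>z. ln_Gamma (?p z) - ln_Gamma (1/2)) holomorphic_on right_halfplane"
      by (intro holomorphic_intros)
    show "exp (ln_Gamma (?p z) - ln_Gamma (1/2)) = Gamma (?p z) / of_real (sqrt pi)"
      if "z \<in> right_halfplane" for z
      using np_int[of z] that
      by (simp add: exp_diff exp_half Gamma_complex_altdef right_halfplane_def)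
    fix x :: real assume x: "x > 0"
    have "?p (of_real x) = of_real (1/2 + x * r / pi)" by simp
    moreover have "1/2 + x * r / pi > 0" using x r by (simp add: add_pos_pos)
    ultimately have "ln_Gamma (?p (of_real x)) - ln_Gamma (1/2) =
        of_real (ln_Gamma (1/2 + x * r / pi) - ln_Gamma (1/2))"
      using half by (simp only: ln_Gamma_complex_of_real of_real_diff)
    thus "ln_Gamma (?p (of_real x)) - ln_Gamma (1/2) \<in> \<real>" by (simp only: Reals_of_real)
  qed
qed (use a in \<open>simp add: right_halfplane_def\<close>)

theorem proposition5:
  fixes y :: real and a :: complex
  assumes "y \<noteq> 0" and "Re a > 0"
  shows
    "(set_integrable lborel {0<..}
        (\<lambda>t::real. tanh (a * t) * complex_of_real (1 / t - 1 / \<bar>y\<bar> * arctan (\<bar>y\<bar> / t))) \<and>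
      (euler_mascheroni :: complex) =
        - complex_of_real (ln 4)
        - pi / (a * \<bar>y\<bar>) * halfplane_ln (\<lambda>z. Gamma (1 / 2 + z * \<bar>y\<bar> / pi) / sqrt pi) a
        + (LINT t:{0<..}|lborel.
             tanh (a * t) * complex_of_real (1 / t - 1 / \<bar>y\<bar> * arctan (\<bar>y\<bar> / t)))) \<and>
     (set_integrable lborel {0<..}
        (\<lambda>t::real. halfplane_ln (\<lambda>z. cosh (z * t)) a / complex_of_real (t\<^sup>2 * (t\<^sup>2 + y\<^sup>2))) \<and>
      (euler_mascheroni :: complex) =
        - complex_of_real (ln 4)
        - pi / (a * \<bar>y\<bar>) * halfplane_ln (\<lambda>z. Gamma (1 / 2 + z * \<bar>y\<bar> / pi) / sqrt pi) a
        + complex_of_real (y\<^sup>2) / a *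
          (LINT t:{0<..}|lborel.
             halfplane_ln (\<lambda>z. cosh (z * t)) a / complex_of_real (t\<^sup>2 * (t\<^sup>2 + y\<^sup>2)))) \<and>
     (set_integrable lborel {0<..}
        (\<lambda>t::real. halfplane_ln (\<lambda>z. cosh (z * t)) a / (a * complex_of_real (t\<^sup>2))
                 - complex_of_real (t / (t\<^sup>2 + y\<^sup>2))) \<and>
      (euler_mascheroni :: complex) =
        1 - halfplane_ln (\<lambda>z. 4 * z * \<bar>y\<bar> / pi) a
        + (LINT t:{0<..}|lborel.
             halfplane_ln (\<lambda>z. cosh (z * t)) a / (a * complex_of_real (t\<^sup>2))
             - complex_of_real (t / (t\<^sup>2 + y\<^sup>2)))) \<and>
     (set_integrable lborel {0<..}
        (\<lambda>t::real. halfplane_ln (\<lambda>z. cosh (z * t)) a / (a * complex_of_real (t\<^sup>2))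
                 - complex_of_real (1 / \<bar>y\<bar> * arctan (\<bar>y\<bar> / t))) \<and>
      (euler_mascheroni :: complex) =
        2 - halfplane_ln (\<lambda>z. 4 * z * \<bar>y\<bar> / pi) a
        + (LINT t:{0<..}|lborel.
             halfplane_ln (\<lambda>z. cosh (z * t)) a / (a * complex_of_real (t\<^sup>2))
             - complex_of_real (1 / \<bar>y\<bar> * arctan (\<bar>y\<bar> / t)))) \<and>
     (set_integrable lborel {0<..}
        (\<lambda>t::real. tanh (a * t) / complex_of_real t
                 - complex_of_real (1 / \<bar>y\<bar> * arctan (\<bar>y\<bar> / t))) \<and>
      (euler_mascheroni :: complex) =
        1 - halfplane_ln (\<lambda>z. 4 * z * \<bar>y\<bar> / pi) a
        + (LINT t:{0<..}|lborel.
             tanh (a * t) / complex_of_real t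
             - complex_of_real (1 / \<bar>y\<bar> * arctan (\<bar>y\<bar> / t))))"
proof -
  define r where "r = \<bar>y\<bar>"
  have r: "r > 0" using assms(1) by (simp add: r_def)
  have y2: "y\<^sup>2 = r\<^sup>2" by (simp add: r_def)
  note a = assms(2)
  have a0: "a \<noteq> 0" using a by auto
  let ?\<gamma> = "euler_mascheroni :: complex"
  define G where "G = ln_Gamma (1/2 + a * of_real r / of_real pi) - ln_Gamma (1/2)"
  define V where "V = of_real pi / (a * of_real r) * G + ?\<gamma> + of_real (ln 4)"
  define W where "W = ?\<gamma> + Ln (4 * a * of_real r / of_real pi)"
  \<comment> \<open>\<open>I1\<close> to \<open>I5\<close> evaluate the integrals of the five formulas; the last three are obtained from \<open>J\<close> with \<open>K\<close> and \<open>L\<close>.\<close>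
  have I1: "half_line_integral (\<lambda>t. tanh (a * of_real t) * of_real (1 / t - 1 / r * arctan (r / t))) V"
    using tanh_arctan_integral[OF a r]
    by (rule half_line_integral_cong) (simp_all add: V_def G_def Digamma_one_half_complex)
  have I2: "half_line_integral
      (\<lambda>t. halfplane_ln (\<lambda>z. cosh (z * of_real t)) a / of_real (t\<^sup>2 * (t\<^sup>2 + r\<^sup>2))) (a / of_real (r\<^sup>2) * V)"
    using ln_cosh_kernel_integral[OF a r I1]
    by (rule half_line_integral_cong) (simp_all add: halfplane_ln_cosh[OF _ a])
  have J: "half_line_integral (\<lambda>t. tanh (a * of_real t) / of_real t - of_real (t / (t\<^sup>2 + r\<^sup>2))) W"
    unfolding W_def by (rule tanh_minus_rational_integral[OF a r])
  note K = arctan_minus_rational_integral[OF r]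
  have I5: "half_line_integral (\<lambda>t. tanh (a * of_real t) / of_real t - of_real (1 / r * arctan (r / t))) (W - 1)"
    by (rule half_line_integral_cong[OF half_line_integral_diff[OF J K]]) simp_all
  note L = ln_cosh_minus_tanh_integral[OF a]
  have I3: "half_line_integral
      (\<lambda>t. halfplane_ln (\<lambda>z. cosh (z * of_real t)) a / (a * of_real (t\<^sup>2)) - of_real (t / (t\<^sup>2 + r\<^sup>2))) (W - 1)"
    by (rule half_line_integral_cong[OF half_line_integral_add[OF L J]])
       (simp_all add: halfplane_ln_cosh[OF _ a])
  have I4: "half_line_integral
      (\<lambda>t. halfplane_ln (\<lambda>z. cosh (z * of_real t)) a / (a * of_real (t\<^sup>2)) - of_real (1 / r * arctan (r / t))) (W - 2)"
    by (rule half_line_integral_cong[OF half_line_integral_add[OF L I5]])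
       (simp_all add: halfplane_ln_cosh[OF _ a])
  have lnG: "halfplane_ln (\<lambda>z. Gamma (1/2 + z * of_real r / of_real pi) / of_real (sqrt pi)) a = G"
    unfolding G_def by (rule halfplane_ln_Gamma[OF r a])
  have lnL: "halfplane_ln (\<lambda>z. 4 * z * of_real r / of_real pi) a = Ln (4 * a * of_real r / of_real pi)"
    by (rule halfplane_ln_four_mult[OF r a])
  have W: "?\<gamma> = 1 - Ln (4 * a * of_real r / of_real pi) + (W - 1)"
          "?\<gamma> = 2 - Ln (4 * a * of_real r / of_real pi) + (W - 2)"
    by (simp_all add: W_def)
  have V: "?\<gamma> = - of_real (ln 4) - of_real pi / (a * of_real r) * G + V"
    by (simp add: V_def)
  have V2: "of_real (r\<^sup>2) / a * (a / of_real (r\<^sup>2) * V) = V"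
    using a0 r by simp
  show ?thesis
    unfolding r_def[symmetric] y2 lnG lnL
    using I1 I2 I3 I4 I5 unfolding half_line_integral_iff
    by (intro conjI) (simp_all only: V2 V[symmetric] W[symmetric])
qed

end
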